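(* Let $K=\sum_{n\ge0}\kappa_n\otimes(e_n\otimes e_n^* )$, an $\mathcal{L}(\ell^2)$-valued kernel on the Cantor group $G$. The operator $f\mapsto \mathrm{P.V.}(K*f)$ coincides, for $f\in L^2(G,\ell^2)$, with the orthogonal projection $P:L^2(G,\ell^2)\to\iota(H^2(\delta))$, and for $f\in L^1(G,\ell^2)$ the principal value exists almost everywhere and defines a bounded operator $L^1(G,\ell^2)\to L^{1,\infty}(G,\ell^2)$ (hence a bounded operator $L^p(G,\ell^2)\to L^p(G,\ell^2)$ for every $1<p<\infty$).
   Context: $G=\mathbb{Z}_2^{\mathbb{N}^+}$ (elements $x=(x_1,x_2,\dots)$, $x_k\in\{0,1\}$, identified with subsets of $\mathbb{N}^+$, $\emptyset$ the identity), with Haar probability measure $\mu$, coordinatewise addition mod 2, and metric $d(x,y)=2^{-\min\{k:x_k\ne y_k\}}$ (with $\min\emptyset=\infty$); $\min x=\min\{k:x_k=1\}$. For finite $A\subset\mathbb{N}^+$, $w_A(x)=(-1)^{\sum_{k\in A}x_k}$, with $\max\emptyset=0$. $\mathcal{F}_n$ is the $\sigma$-algebra generated by $x_1,\dots,x_n$, $\mathbb{E}_n$ its conditional expectation, $\Delta_0=\mathbb{E}_0$, $\Delta_n=\mathbb{E}_n-\mathbb{E}_{n-1}$ ($n\ge1$); $\Delta_nf=\sum_{\max A=n}\langle f,w_A\rangle w_A$. Set $\kappa_n=\sum_{\max A=n}w_A$; explicitly $\kappa_0\equiv1$ and for $n\ge1$: $\kappa_n(x)=2^{n-1}$ if $n<\min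 x$, $-2^{n-1}$ if $n=\min x$, $0$ if $n>\min x$, so $\Delta_n f=\kappa_n*f$. $(e_n)_{n\ge0}$ is the unit vector basis of $\ell^2$ and $e_n^*$ the $n$-th coordinate functional. Convolution: $(K*f)(x)=\int_G K(y)f(x-y)\,d\mu(y)$, and $\mathrm{P.V.}(K*f)(x)=\lim_{r\to0}\int_{G\setminus B(\emptyset,r)}K(y)f(x-y)\,d\mu(y)$. $\iota(H^2(\delta))=\{(f_n)_{n\ge0}\in L^2(G,\ell^2):\Delta_nf_n=f_n\ \forall n\}$ (the $L^2(\ell^2)$-closed span of $w_A\otimes e_{\max A}$). $L^{1,\infty}(G,\ell^2)$ is weak $L^1$ with quasinorm $\sup_{\lambda>0}\lambda\mu\{\|g\|_{\ell^2}>\lambda\}$. *)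

theory Defs
  imports "HOL-Probability.Probability"
begin

text \<open>Cantor group. An element x = (x_1, x_2, ...) of Z_2^{N+} is represented as a
  function g :: nat => bool with g j = (x_{j+1} = 1), i.e. coordinate k is stored at
  position k - 1.  The identity (empty set) is the constant False function.\<close>

type_synonym cantor = "nat \<Rightarrow> bool"

definition czero :: cantor where "czero = (\<lambda>_. False)"

definition cadd :: "cantor \<Rightarrow> cantor \<Rightarrow> cantor" where
  "cadd x y = (\<lambda>k. x k \<noteq> y k)"

definition muG :: "cantor measure" where
  "muG = PiM UNIV (\<lambda>_::nat. measure_pmf (bernoulli_pmf (1/2)))"

text \<open>Metric d(x,y) = 2^(-min{k : x_k \<noteq> y_k}) (k 1-based), 0 if x = y.\<close>
definition cdist :: "cantor \<Rightarrow> cantor \<Rightarrow> real" where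
  "cdist x y = (if x = y then 0 else (1/2) ^ Suc (LEAST j. x j \<noteq> y j))"

text \<open>kappa_0 = 1; for n >= 1: 2^(n-1) if n < min x, -2^(n-1) if n = min x, 0 otherwise.\<close>
definition kappa :: "nat \<Rightarrow> cantor \<Rightarrow> real" where
  "kappa n x = (if n = 0 then 1
     else if (\<forall>j<n. \<not> x j) then 2 ^ (n - 1)
     else if (\<forall>j<n - 1. \<not> x j) \<and> x (n - 1) then - (2 ^ (n - 1))
     else 0)"

text \<open>l^2 norm of a sequence nat => real (meaningful when square summable).\<close>
definition l2norm :: "(nat \<Rightarrow> real) \<Rightarrow> real" where
  "l2norm v = sqrt (\<Sum>n. (v n)\<^sup>2)"

text \<open>L^p(G, l^2): coordinatewise measurable (equivalent to strong measurability for the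
  separable space l^2), a.e. l^2-valued, and with finite p-th moment of the l^2 norm.\<close>
definition inLp :: "real \<Rightarrow> (cantor \<Rightarrow> nat \<Rightarrow> real) \<Rightarrow> bool" where
  "inLp p f \<longleftrightarrow> (\<forall>n. (\<lambda>x. f x n) \<in> borel_measurable muG)
     \<and> (AE x in muG. summable (\<lambda>n. (f x n)\<^sup>2))
     \<and> (\<integral>\<^sup>+ x. ennreal (l2norm (f x) powr p) \<partial>muG) < \<infinity>"

definition Fn :: "nat \<Rightarrow> cantor measure" where
  "Fn n = sigma (space muG) ((\<lambda>j. {x \<in> space muG. x j}) ` {..<n})"

definition Delta :: "nat \<Rightarrow> (cantor \<Rightarrow> real) \<Rightarrow> cantor \<Rightarrow> real" where
  "Delta n f = (if n = 0 then real_cond_exp muG (Fn 0) f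
     else (\<lambda>x. real_cond_exp muG (Fn n) f x - real_cond_exp muG (Fn (n - 1)) f x))"

definition inH2 :: "(cantor \<Rightarrow> nat \<Rightarrow> real) \<Rightarrow> bool" where
  "inH2 g \<longleftrightarrow> inLp 2 g \<and> (\<forall>n. AE x in muG. Delta n (\<lambda>y. g y n) x = g x n)"

definition is_orth_proj :: "(cantor \<Rightarrow> nat \<Rightarrow> real) \<Rightarrow> (cantor \<Rightarrow> nat \<Rightarrow> real) \<Rightarrow> bool" where
  "is_orth_proj f g \<longleftrightarrow> inH2 g \<and>
     (\<forall>h. inH2 h \<longrightarrow> (\<integral>x. (\<Sum>n. (f x n - g x n) * h x n) \<partial>muG) = 0)"

definition trunc_conv :: "real \<Rightarrow> (cantor \<Rightarrow> nat \<Rightarrow> real) \<Rightarrow> cantor \<Rightarrow> nat \<Rightarrow> real" where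
  "trunc_conv r f x n =
     (\<integral>y. indicator {y. r \<le> cdist czero y} y * kappa n y * f (cadd x y) n \<partial>muG)"

definition pv_conv :: "(cantor \<Rightarrow> nat \<Rightarrow> real) \<Rightarrow> cantor \<Rightarrow> (nat \<Rightarrow> real) \<Rightarrow> bool" where
  "pv_conv f x v \<longleftrightarrow>
     ((\<lambda>r. \<Sum>n. ennreal ((trunc_conv r f x n - v n)\<^sup>2)) \<longlongrightarrow> 0) (at_right (0::real))"

end

theory Submission
  imports Defs
begin

text \<open>
  Convolution with \<open>\<kappa>\<^sub>n\<close> is the martingale difference operator \<open>\<Delta>\<^sub>n\<close>, so the principal value should
  be \<open>(\<Delta>\<^sub>n f\<^sub>n)\<^sub>n\<close>.  Let \<open>\<phi> = \<parallel>f\<parallel>\<close> (the \<open>\<ell>\<^sup>2\<close> norm) and \<open>M\<^sub>k = max\<^sub>j\<^sub>\<le>\<^sub>k E\<^sub>j \<phi>\<close>.  For decreasing adapted weights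
  \<open>w\<^sub>k\<close>, the sum of \<open>w\<^sub>k\<^sub>-\<^sub>1 |\<Delta>\<^sub>k f\<^sub>k|\<^sup>2\<close> has integral at most that of \<open>w\<^sub>k\<^sub>-\<^sub>1 (\<parallel>E\<^sub>k f\<parallel>\<^sup>2 - \<parallel>E\<^sub>k\<^sub>-\<^sub>1 f\<parallel>\<^sup>2)\<close>,
  which summation by parts controls through \<open>\<parallel>E\<^sub>k f\<parallel> \<le> E\<^sub>k \<phi> \<le> 2 E\<^sub>k\<^sub>-\<^sub>1 \<phi>\<close>.  The weight
  \<open>1[M\<^sub>k \<le> t]\<close> gives the weak type estimate, and the weight \<open>M\<^sub>k\<^bsup>p-2\<^esup>\<close> together with Doob's inequality
  gives the case \<open>1 < p < 2\<close>; no interpolation is involved.  For \<open>p \<ge> 2\<close> one uses that \<open>|\<Delta>\<^sub>k f|\<^sup>2\<close>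
  is predictable on the Cantor group: with \<open>A\<close> the square function and \<open>q = p/2\<close>,
  \<open>\<integral> A\<^sup>q \<le> q \<Sum>\<^sub>k \<integral> |\<Delta>\<^sub>k f\<^sub>k|\<^sup>2 A\<^sub>k\<^bsup>q-1\<^esup> \<le> q \<integral> \<phi>\<^sup>2 A\<^bsup>q-1\<^esup>\<close>, and Young's inequality absorbs the last factor.

  The kernel truncated at level \<open>N\<close> gives \<open>\<Delta>\<^sub>n f\<^sub>n\<close> minus at most \<open>2\<^bsup>n-N\<^esup> E\<^sub>N f\<^sub>n\<close> for \<open>n \<le> N\<close>, and zero
  for \<open>n > N\<close>.  The correction tends to zero for each fixed \<open>n\<close>, and uniformly over the remaining
  coordinates by the weak type maximal inequality for the tails of \<open>f\<close>.
\<close>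

section \<open>Haar measure and averaging operators\<close>

interpretation muG: prob_space muG
  unfolding muG_def by (intro prob_space_PiM measure_pmf.prob_space_axioms)

lemma space_muG [simp]: "space muG = UNIV"
  by (simp add: muG_def space_PiM)

lemma measurable_muG_component [measurable]: "(\<lambda>x. x j) \<in> measurable muG (count_space UNIV)"
proof -
  have "(\<lambda>x. x j) \<in> measurable muG (measure_pmf (bernoulli_pmf (1/2)))"
    unfolding muG_def by measurable
  then show ?thesis by simp
qed

lemma measurable_into_muG:
  assumes "\<And>j. (\<lambda>x. f x j) \<in> measurable M (count_space UNIV)"
  shows "f \<in> measurable M muG"
  unfolding muG_def by (rule measurable_PiM_single') (use assms in simp_all)

lemma measurable_cadd [measurable (raw)]:
  assumes [measurable]: "f \<in> measurable M muG" "g \<in> measurable M muG"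
  shows "(\<lambda>x. cadd (f x) (g x)) \<in> measurable M muG"
  unfolding cadd_def by (rule measurable_into_muG) measurable

lemma cadd_commute: "cadd x y = cadd y x"
  by (auto simp: cadd_def fun_eq_iff)

lemma cadd_assoc: "cadd (cadd x y) z = cadd x (cadd y z)"
  by (auto simp: cadd_def fun_eq_iff)

lemma cadd_cancel [simp]: "cadd x (cadd x y) = y"
  by (auto simp: cadd_def fun_eq_iff)

lemma cadd_cancel' [simp]: "cadd (cadd y x) x = y"
  by (auto simp: cadd_def fun_eq_iff)

text \<open>Both bits carry mass 1/2, so exclusive or with a fixed bit preserves the fair coin. This
  is the one-coordinate case of translation invariance.\<close>

lemma emeasure_bernoulli_half_translate:
  "emeasure (measure_pmf (bernoulli_pmf (1/2))) {b. (c \<noteq> b) \<in> A}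
    = emeasure (measure_pmf (bernoulli_pmf (1/2))) A"
proof -
  have "bernoulli_pmf (1/2) = map_pmf (\<lambda>b. c \<noteq> b) (bernoulli_pmf (1/2))"
  proof (rule pmf_eqI)
    fix i :: bool
    have "pmf (map_pmf (\<lambda>b. c \<noteq> b) (bernoulli_pmf (1/2))) ((\<lambda>b. c \<noteq> b) (c \<noteq> i))
            = pmf (bernoulli_pmf (1/2)) (c \<noteq> i)"
      by (rule pmf_map_inj') (auto simp: inj_def)
    then show "pmf (bernoulli_pmf (1/2)) i = pmf (map_pmf (\<lambda>b. c \<noteq> b) (bernoulli_pmf (1/2))) i"
      by (cases i; cases c) auto
  qed
  then have "emeasure (measure_pmf (bernoulli_pmf (1/2))) A
     = emeasure (measure_pmf (map_pmf (\<lambda>b. c \<noteq> b) (bernoulli_pmf (1/2)))) A"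
    by simp
  also have "\<dots> = emeasure (measure_pmf (bernoulli_pmf (1/2))) {b. (c \<noteq> b) \<in> A}"
    by (simp add: vimage_def)
  finally show ?thesis by simp
qed

text \<open>Makes \<open>muG\<close> the Haar measure: a product measure is determined by its
  finite-dimensional cylinders, and translation acts on each coordinate by a map that preserves the
  factor.\<close>

lemma distr_cadd_muG: "distr muG muG (cadd x) = muG"
proof -
  interpret P: product_prob_space "\<lambda>_::nat. measure_pmf (bernoulli_pmf (1/2))" UNIV
    by standard
  have m: "cadd x \<in> measurable muG muG" by measurable
  have "distr muG muG (cadd x) = PiM UNIV (\<lambda>_::nat. measure_pmf (bernoulli_pmf (1/2)))"
  proof (rule P.PiM_eq)
    show "sets (distr muG muG (cadd x)) = sets (Pi\<^sub>M UNIV (\<lambda>_::nat. measure_pmf (bernoulli_pmf (1/2))))"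
      by (simp add: muG_def)
  next
    fix J :: "nat set" and F :: "nat \<Rightarrow> bool set"
    assume J: "finite J" and F: "\<And>j. j \<in> J \<Longrightarrow> F j \<in> sets (measure_pmf (bernoulli_pmf (1/2)))"
    let ?B = "\<lambda>_::nat. measure_pmf (bernoulli_pmf (1/2))"
    have meas: "prod_emb UNIV ?B J (Pi\<^sub>E J F) \<in> sets muG"
      unfolding muG_def using J by (intro sets_PiM_I) auto
    \<comment> \<open>The preimage of a cylinder is again a cylinder, with every factor translated
      separately.\<close>
    have eq: "cadd x -` prod_emb UNIV ?B J (Pi\<^sub>E J F) \<inter> space muG
        = prod_emb UNIV ?B J (Pi\<^sub>E J (\<lambda>j. {b. (x j \<noteq> b) \<in> F j}))"
      by (auto simp: prod_emb_def cadd_def PiE_iff)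
    have "emeasure (distr muG muG (cadd x)) (prod_emb UNIV ?B J (Pi\<^sub>E J F))
        = emeasure muG (prod_emb UNIV ?B J (Pi\<^sub>E J (\<lambda>j. {b. (x j \<noteq> b) \<in> F j})))"
      using emeasure_distr[OF m meas] eq by simp
    also have "\<dots> = (\<Prod>j\<in>J. emeasure (measure_pmf (bernoulli_pmf (1/2))) {b. (x j \<noteq> b) \<in> F j})"
      unfolding muG_def using J by (subst P.emeasure_PiM_emb) auto
    also have "\<dots> = (\<Prod>j\<in>J. emeasure (measure_pmf (bernoulli_pmf (1/2))) (F j))"
      by (simp only: emeasure_bernoulli_half_translate)
    finally show "emeasure (distr muG muG (cadd x)) (prod_emb UNIV ?B J (Pi\<^sub>E J F))
        = (\<Prod>j\<in>J. emeasure (measure_pmf (bernoulli_pmf (1/2))) (F j))" .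
  qed
  then show ?thesis by (simp add: muG_def)
qed

lemma integral_cadd:
  fixes f :: "cantor \<Rightarrow> real"
  assumes [measurable]: "f \<in> borel_measurable muG"
  shows "(\<integral>y. f (cadd x y) \<partial>muG) = (\<integral>y. f y \<partial>muG)"
proof -
  have "(\<integral>y. f y \<partial>(distr muG muG (cadd x))) = (\<integral>y. f (cadd x y) \<partial>muG)"
    by (rule integral_distr) measurable
  then show ?thesis by (simp add: distr_cadd_muG)
qed

lemma integrable_cadd:
  fixes f :: "cantor \<Rightarrow> real"
  assumes "integrable muG f"
  shows "integrable muG (\<lambda>y. f (cadd x y))"
  using assms by (intro integrable_distr[where M'=muG and T="cadd x"]) (auto simp: distr_cadd_muG)

lemma AE_cadd:
  assumes "AE y in muG. P y"
  shows "AE y in muG. P (cadd x y)"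
  by (rule AE_distrD[where M'=muG and f="cadd x"]) (use assms in \<open>simp, simp only: distr_cadd_muG\<close>)

section \<open>Cylinder subgroups and averages over their cosets\<close>

definition cyl :: "nat \<Rightarrow> cantor set" where
  "cyl k = {y. \<forall>j<k. \<not> y j}"

lemma measurable_mem_cyl [measurable]: "Measurable.pred muG (\<lambda>y. y \<in> cyl k)"
  unfolding cyl_def by simp

lemma sets_cyl [measurable]: "cyl k \<in> sets muG"
  using measurable_mem_cyl[of k] by (simp add: pred_def)

lemma cadd_mem_cyl_iff: "y \<in> cyl k \<Longrightarrow> cadd x y \<in> cyl k \<longleftrightarrow> x \<in> cyl k"
  by (auto simp: cyl_def cadd_def)

lemma cyl_antimono: "j \<le> k \<Longrightarrow> cyl k \<subseteq> cyl j"
  by (auto simp: cyl_def)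

lemma cyl_0 [simp]: "cyl 0 = UNIV"
  by (simp add: cyl_def)

lemma measure_cyl: "measure muG (cyl k) = (1/2) ^ k"
proof -
  interpret P: product_prob_space "\<lambda>_::nat. measure_pmf (bernoulli_pmf (1/2))" UNIV
    by standard
  let ?B = "\<lambda>_::nat. measure_pmf (bernoulli_pmf (1/2))"
  have "cyl k = prod_emb UNIV ?B {..<k} (Pi\<^sub>E {..<k} (\<lambda>_. {False}))"
    by (auto simp: cyl_def prod_emb_def restrict_def fun_eq_iff split: if_splits)
  then have "measure muG (cyl k) = (\<Prod>j<k. measure (measure_pmf (bernoulli_pmf (1/2))) {False})"
    unfolding muG_def by (simp only:) (subst P.measure_PiM_emb, auto)
  then show ?thesis by (simp add: measure_pmf_single)
qed

text \<open>The conditional expectation with respect to the first \<open>k\<close> coordinates, as convolution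
  with the normalised indicator of the subgroup \<open>cyl k\<close>; this version is defined at every point.\<close>
definition avg :: "nat \<Rightarrow> (cantor \<Rightarrow> real) \<Rightarrow> cantor \<Rightarrow> real" where
  "avg k f x = 2 ^ k * (\<integral>y. indicator (cyl k) y * f (cadd x y) \<partial>muG)"

text \<open>Dependence on the first \<open>k\<close> coordinates alone, expressed through the
  subgroup \<open>cyl k\<close>. It serves as a pointwise version of measurability with respect to
  \<open>Fn k\<close>; \<open>cinv_of_Fn_sets\<close> and \<open>cinv_measurable_Fn\<close> are the
  bridge.\<close>

definition cinv :: "nat \<Rightarrow> (cantor \<Rightarrow> 'a) \<Rightarrow> bool" where
  "cinv k u \<longleftrightarrow> (\<forall>x. \<forall>y\<in>cyl k. u (cadd x y) = u x)"

lemma cinv_mono: "cinv j u \<Longrightarrow> j \<le> k \<Longrightarrow> cinv k u"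
  using cyl_antimono[of j k] by (auto simp: cinv_def)

lemma integrable_indicator_cyl_cadd:
  fixes f :: "cantor \<Rightarrow> real"
  assumes "integrable muG f"
  shows "integrable muG (\<lambda>y. indicator (cyl k) y * f (cadd x y))"
  using integrable_real_mult_indicator[OF sets_cyl integrable_cadd[OF assms]]
  by (simp add: mult.commute)

lemma borel_measurable_avg [measurable]:
  assumes [measurable]: "f \<in> borel_measurable muG"
  shows "avg k f \<in> borel_measurable muG"
  unfolding avg_def by measurable

lemma avg_cong_AE:
  assumes "AE x in muG. f x = g x"
    and [measurable]: "f \<in> borel_measurable muG" "g \<in> borel_measurable muG"
  shows "avg k f x = avg k g x"
proof -
  have "(\<integral>y. indicator (cyl k) y * f (cadd x y) \<partial>muG) = (\<integral>y. indicator (cyl k) y * g (cadd x y) \<partial>muG)"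
    by (rule integral_cong_AE) (use AE_cadd[OF assms(1), of x] in auto)
  then show ?thesis by (simp add: avg_def)
qed

lemma avg_mono_AE:
  assumes "AE x in muG. f x \<le> g x" "integrable muG f" "integrable muG g"
  shows "avg k f x \<le> avg k g x"
  unfolding avg_def
  by (intro mult_left_mono integral_mono_AE integrable_indicator_cyl_cadd assms)
     (use AE_cadd[OF assms(1), of x] in \<open>auto simp: indicator_def\<close>)

lemma avg_add:
  assumes "integrable muG f" "integrable muG g"
  shows "avg k (\<lambda>x. f x + g x) x = avg k f x + avg k g x"
  using assms by (simp add: avg_def distrib_left integrable_indicator_cyl_cadd)

lemma avg_diff:
  assumes "integrable muG f" "integrable muG g"
  shows "avg k (\<lambda>x. f x - g x) x = avg k f x - avg k g x"
  using assms by (simp add: avg_def right_diff_distrib integrable_indicator_cyl_cadd)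

lemma avg_sum:
  assumes "\<And>i. i \<in> I \<Longrightarrow> integrable muG (f i)"
  shows "avg k (\<lambda>x. \<Sum>i\<in>I. f i x) x = (\<Sum>i\<in>I. avg k (f i) x)"
  using assms by (simp add: avg_def sum_distrib_left integrable_indicator_cyl_cadd Bochner_Integration.integral_sum)

text \<open>The integrand lives on the coset of \<open>x\<close>, on which \<open>u\<close> has the
  constant value \<open>u x\<close>; this is the pull-out property of conditional expectation, at
  every point.\<close>

lemma avg_mult_cinv:
  assumes "cinv k u"
  shows "avg k (\<lambda>x. u x * f x) x = u x * avg k f x"
proof -
  have "(\<integral>y. indicator (cyl k) y * (u (cadd x y) * f (cadd x y)) \<partial>muG)
      = (\<integral>y. u x * (indicator (cyl k) y * f (cadd x y)) \<partial>muG)"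
    using assms by (intro Bochner_Integration.integral_cong) (auto simp: cinv_def indicator_def)
  then show ?thesis by (simp add: avg_def)
qed

lemma avg_cmult: "avg k (\<lambda>x. c * f x) x = c * avg k f x"
  using avg_mult_cinv[of k "\<lambda>_. c" f x] by (simp add: cinv_def)

lemma avg_const [simp]: "avg k (\<lambda>_. c) x = c"
  by (simp add: avg_def measure_cyl power_one_over)

lemma avg_nonneg: "(\<And>x. 0 \<le> f x) \<Longrightarrow> 0 \<le> avg k f x"
  unfolding avg_def by (intro mult_nonneg_nonneg integral_nonneg_AE) auto

lemma avg_0: "f \<in> borel_measurable muG \<Longrightarrow> avg 0 f x = (\<integral>y. f y \<partial>muG)"
  by (simp add: avg_def integral_cadd)

lemma cinv_avg:
  assumes [measurable]: "f \<in> borel_measurable muG"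
  shows "cinv k (avg k f)"
  unfolding cinv_def
proof safe
  fix x z assume z: "z \<in> cyl k"
  have "(\<integral>y. indicator (cyl k) y * f (cadd x y) \<partial>muG)
      = (\<integral>y. indicator (cyl k) (cadd z y) * f (cadd x (cadd z y)) \<partial>muG)"
    by (rule integral_cadd[symmetric]) measurable
  also have "\<dots> = (\<integral>y. indicator (cyl k) y * f (cadd (cadd x z) y) \<partial>muG)"
    using cadd_mem_cyl_iff[OF z] by (simp add: cadd_assoc indicator_def cadd_commute[of z])
  finally show "avg k f (cadd x z) = avg k f x" by (simp add: avg_def)
qed

lemma avg_cinv: "cinv k u \<Longrightarrow> avg k u x = u x"
  using avg_mult_cinv[of k u "\<lambda>_. 1" x] by simp

lemma abs_avg_le_avg_abs:
  shows "\<bar>avg k f x\<bar> \<le> avg k (\<lambda>x. \<bar>f x\<bar>) x"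
proof -
  have "\<bar>\<integral>y. indicator (cyl k) y * f (cadd x y) \<partial>muG\<bar> \<le> (\<integral>y. \<bar>indicator (cyl k) y * f (cadd x y)\<bar> \<partial>muG)"
    by (rule integral_abs_bound)
  then show ?thesis by (simp add: avg_def abs_mult)
qed

text \<open>The doubling property of the filtration: passing from \<open>cyl k\<close> to its
  subgroup of index 2 doubles the normalising factor and shrinks the domain of a nonnegative
  integrand. The stopping arguments below rest on it.\<close>

lemma avg_Suc_le:
  assumes "integrable muG f" "\<And>x. 0 \<le> f x"
  shows "avg (Suc k) f x \<le> 2 * avg k f x"
proof -
  have "(\<integral>y. indicator (cyl (Suc k)) y * f (cadd x y) \<partial>muG) \<le> (\<integral>y. indicator (cyl k) y * f (cadd x y) \<partial>muG)"
    using assms cyl_antimono[of k "Suc k"]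
    by (intro integral_mono integrable_indicator_cyl_cadd) (auto simp: indicator_def)
  then show ?thesis by (simp add: avg_def)
qed

text \<open>Iterates doubling from level 0. In consequence averages of integrable functions are
  bounded, and products of averages are integrable.\<close>

lemma avg_le_integral:
  assumes "integrable muG f" "\<And>x. 0 \<le> f x"
  shows "avg k f x \<le> 2 ^ k * (\<integral>y. f y \<partial>muG)"
proof (induction k)
  case 0
  then show ?case using assms by (simp add: avg_0)
next
  case (Suc k)
  then show ?case using avg_Suc_le[OF assms, of k x] by simp
qed

lemma abs_avg_le_integral:
  assumes "integrable muG f"
  shows "\<bar>avg k f x\<bar> \<le> 2 ^ k * (\<integral>y. \<bar>f y\<bar> \<partial>muG)"
  using abs_avg_le_avg_abs[of k f x] avg_le_integral[of "\<lambda>x. \<bar>f x\<bar>" k x] assms by simp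

lemma integrable_avg [intro]:
  assumes "integrable muG f"
  shows "integrable muG (avg k f)"
  by (rule muG.integrable_const_bound[where B="2 ^ k * (\<integral>y. \<bar>f y\<bar> \<partial>muG)"])
     (use abs_avg_le_integral[OF assms] assms in auto)

text \<open>By Fubini and translation invariance the inner integral over \<open>x\<close> is the
  integral of \<open>f\<close> for each \<open>y\<close> in \<open>cyl k\<close>, and
  \<open>cyl k\<close> has measure \<open>(1/2) ^ k\<close>.\<close>

lemma integral_avg:
  assumes f: "integrable muG f"
  shows "(\<integral>x. avg k f x \<partial>muG) = (\<integral>x. f x \<partial>muG)"
proof -
  interpret P: pair_sigma_finite muG muG ..
  have [measurable]: "f \<in> borel_measurable muG" using f by auto
  let ?h = "\<lambda>(y, x). indicator (cyl k) y * f (cadd x y)"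
  have int: "integrable (muG \<Otimes>\<^sub>M muG) ?h"
  proof (rule P.Fubini_integrable)
    show "integrable muG (\<lambda>y. \<integral>x. norm (?h (y, x)) \<partial>muG)"
    proof (rule muG.integrable_const_bound[where B="\<integral>x. \<bar>f x\<bar> \<partial>muG"])
      have "(\<integral>x. norm (?h (y, x)) \<partial>muG) = indicator (cyl k) y * (\<integral>x. \<bar>f x\<bar> \<partial>muG)" for y
        using integral_cadd[of "\<lambda>x. \<bar>f x\<bar>" y] by (simp add: abs_mult cadd_commute[of _ y])
      then show "AE y in muG. norm (\<integral>x. norm (?h (y, x)) \<partial>muG) \<le> (\<integral>x. \<bar>f x\<bar> \<partial>muG)"
        by (auto simp: indicator_def)
    qed measurable
    show "AE y in muG. integrable muG (\<lambda>x. ?h (y, x))"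
      using integrable_cadd[OF f] by (simp add: cadd_commute)
  qed measurable
  have "(\<integral>x. (\<integral>y. indicator (cyl k) y * f (cadd x y) \<partial>muG) \<partial>muG)
      = (\<integral>y. (\<integral>x. indicator (cyl k) y * f (cadd x y) \<partial>muG) \<partial>muG)"
    using P.Fubini_integral[OF int] by simp
  also have "\<dots> = (\<integral>y. indicator (cyl k) y * (\<integral>x. f x \<partial>muG) \<partial>muG)"
    using integral_cadd[of f] by (simp add: cadd_commute)
  also have "\<dots> = (1/2) ^ k * (\<integral>x. f x \<partial>muG)"
    by (simp add: measure_cyl)
  finally show ?thesis by (simp add: avg_def power_one_over)
qed

lemma integral_cinv_mult_avg:
  assumes "cinv k u" "integrable muG (\<lambda>x. u x * f x)"
  shows "(\<integral>x. u x * avg k f x \<partial>muG) = (\<integral>x. u x * f x \<partial>muG)"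
  using integral_avg[OF assms(2), of k] by (simp add: avg_mult_cinv[OF assms(1)])

lemma cinv_indicator_cyl_cadd: "cinv k (\<lambda>z. indicator (cyl k) (cadd x z))"
  using cadd_mem_cyl_iff by (auto simp: cinv_def indicator_def cadd_assoc[symmetric])

lemma avg_conv:
  assumes [measurable]: "f \<in> borel_measurable muG"
  shows "avg k f x = 2 ^ k * (\<integral>z. indicator (cyl k) (cadd x z) * f z \<partial>muG)"
  unfolding avg_def
  using integral_cadd[of "\<lambda>z. indicator (cyl k) (cadd x z) * f z" x] by simp

lemma avg_avg_le:
  assumes f: "integrable muG f" and "j \<le> k"
  shows "avg j (avg k f) x = avg j f x"
proof -
  have [measurable]: "f \<in> borel_measurable muG" using f by auto
  have "(\<integral>z. indicator (cyl j) (cadd x z) * avg k f z \<partial>muG) = (\<integral>z. indicator (cyl j) (cadd x z) * f z \<partial>muG)"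
  proof (rule integral_cinv_mult_avg)
    show "cinv k (\<lambda>z. indicator (cyl j) (cadd x z) :: real)"
      using cinv_mono[OF cinv_indicator_cyl_cadd assms(2)] .
    show "integrable muG (\<lambda>z. indicator (cyl j) (cadd x z) * f z)"
      by (rule Bochner_Integration.integrable_bound[OF f]) (auto simp: indicator_def)
  qed
  then show ?thesis by (simp add: avg_conv)
qed

lemma avg_avg_ge:
  assumes [measurable]: "f \<in> borel_measurable muG" and "j \<le> k"
  shows "avg k (avg j f) x = avg j f x"
  by (rule avg_cinv) (rule cinv_mono[OF cinv_avg assms(2)], measurable)

section \<open>Martingale differences\<close>

text \<open>Boundedness at every point, bundled with measurability, is stable under sums, products
  and averages; integrability of most products met below then follows from closure rules.\<close>

definition bdd_meas :: "(cantor \<Rightarrow> real) \<Rightarrow> bool" where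
  "bdd_meas u \<longleftrightarrow> u \<in> borel_measurable muG \<and> (\<exists>B. \<forall>x. \<bar>u x\<bar> \<le> B)"

lemma bdd_measI: "u \<in> borel_measurable muG \<Longrightarrow> (\<And>x. \<bar>u x\<bar> \<le> B) \<Longrightarrow> bdd_meas u"
  by (auto simp: bdd_meas_def)

lemma bdd_meas_measurable [dest]: "bdd_meas u \<Longrightarrow> u \<in> borel_measurable muG"
  by (simp add: bdd_meas_def)

lemma bdd_meas_const [simp, intro]: "bdd_meas (\<lambda>_. c)"
  by (rule bdd_measI[where B="\<bar>c\<bar>"]) auto

lemma bdd_meas_add [intro]:
  assumes "bdd_meas u" "bdd_meas v"
  shows "bdd_meas (\<lambda>x. u x + v x)"
proof -
  obtain B C where "\<And>x. \<bar>u x\<bar> \<le> B" "\<And>x. \<bar>v x\<bar> \<le> C" using assms by (auto simp: bdd_meas_def)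
  then have "\<bar>u x + v x\<bar> \<le> B + C" for x
    using abs_triangle_ineq[of "u x" "v x"] by (meson add_mono order_trans)
  then show ?thesis by (rule bdd_measI[OF borel_measurable_add[OF assms[THEN bdd_meas_measurable]]])
qed

lemma bdd_meas_mult [intro]:
  assumes "bdd_meas u" "bdd_meas v"
  shows "bdd_meas (\<lambda>x. u x * v x)"
proof -
  obtain B C where "\<And>x. \<bar>u x\<bar> \<le> B" "\<And>x. \<bar>v x\<bar> \<le> C" using assms by (auto simp: bdd_meas_def)
  then have "\<bar>u x * v x\<bar> \<le> B * C" for x
    unfolding abs_mult by (meson abs_ge_zero mult_mono order_trans)
  then show ?thesis by (rule bdd_measI[OF borel_measurable_times[OF assms[THEN bdd_meas_measurable]]])
qed

lemma bdd_meas_diff [intro]: "bdd_meas u \<Longrightarrow> bdd_meas v \<Longrightarrow> bdd_meas (\<lambda>x. u x - v x)"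
  using bdd_meas_add[of u "\<lambda>x. -1 * v x"] bdd_meas_mult[of "\<lambda>_. -1" v] by simp

lemma bdd_meas_power2 [intro]: "bdd_meas u \<Longrightarrow> bdd_meas (\<lambda>x. (u x)\<^sup>2)"
  unfolding power2_eq_square by auto

lemma bdd_meas_sum [intro]: "(\<And>i. i \<in> I \<Longrightarrow> bdd_meas (u i)) \<Longrightarrow> bdd_meas (\<lambda>x. \<Sum>i\<in>I. u i x)"
  by (induction I rule: infinite_finite_induct) auto

lemma bdd_meas_powr:
  assumes "bdd_meas u" "0 \<le> a" "\<And>x. 0 \<le> u x"
  shows "bdd_meas (\<lambda>x. u x powr a)"
proof -
  obtain B where "\<And>x. \<bar>u x\<bar> \<le> B" using assms by (auto simp: bdd_meas_def)
  then have "\<bar>u x powr a\<bar> \<le> B powr a" for x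
    using assms by (simp add: powr_mono2)
  then show ?thesis using assms by (intro bdd_measI) auto
qed

lemma bdd_meas_integrable: "bdd_meas u \<Longrightarrow> integrable muG u"
  unfolding bdd_meas_def by (metis AE_I2 muG.integrable_const_bound real_norm_def)

lemma bdd_meas_mult_integrable:
  assumes "bdd_meas u" "integrable muG f"
  shows "integrable muG (\<lambda>x. u x * f x)"
proof -
  obtain B where B: "\<And>x. \<bar>u x\<bar> \<le> B" using assms by (auto simp: bdd_meas_def)
  have "integrable muG (\<lambda>x. B * f x)" using assms by simp
  then show ?thesis
  proof (rule Bochner_Integration.integrable_bound)
    show "(\<lambda>x. u x * f x) \<in> borel_measurable muG" using assms by auto
    show "AE x in muG. norm (u x * f x) \<le> norm (B * f x)"
      using B by (auto simp: abs_mult intro!: mult_right_mono order_trans[OF B])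
  qed
qed

lemma bdd_meas_avg [intro]: "integrable muG f \<Longrightarrow> bdd_meas (avg k f)"
  by (rule bdd_measI[OF _ abs_avg_le_integral]) auto

lemma cinv_comp: "cinv k u \<Longrightarrow> cinv k (\<lambda>x. h (u x))"
  by (simp add: cinv_def)

lemma cinv_mult: "cinv k u \<Longrightarrow> cinv k v \<Longrightarrow> cinv k (\<lambda>x. u x * v x)"
  by (simp add: cinv_def)

lemma cinv_diff: "cinv k u \<Longrightarrow> cinv k v \<Longrightarrow> cinv k (\<lambda>x. u x - v x)"
  by (simp add: cinv_def)

lemma integral_bdd_mult_avg:
  assumes "bdd_meas u" "cinv k u" "integrable muG f"
  shows "(\<integral>x. u x * avg k f x \<partial>muG) = (\<integral>x. u x * f x \<partial>muG)"
  using assms by (intro integral_cinv_mult_avg bdd_meas_mult_integrable)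

text \<open>The martingale difference operator \<open>\<Delta>\<^sub>n\<close>, defined at every point.\<close>
definition mdiff :: "nat \<Rightarrow> (cantor \<Rightarrow> real) \<Rightarrow> cantor \<Rightarrow> real" where
  "mdiff n f x = (case n of 0 \<Rightarrow> avg 0 f x | Suc k \<Rightarrow> avg (Suc k) f x - avg k f x)"

lemma mdiff_0: "mdiff 0 f x = avg 0 f x" by (simp add: mdiff_def)
lemma mdiff_Suc: "mdiff (Suc k) f x = avg (Suc k) f x - avg k f x" by (simp add: mdiff_def)

lemma borel_measurable_mdiff [measurable]:
  "f \<in> borel_measurable muG \<Longrightarrow> mdiff n f \<in> borel_measurable muG"
  unfolding mdiff_def by (cases n) auto

lemma bdd_meas_mdiff [intro]: "integrable muG f \<Longrightarrow> bdd_meas (mdiff n f)"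
  unfolding mdiff_def by (cases n) auto

lemma cinv_mdiff: "f \<in> borel_measurable muG \<Longrightarrow> cinv n (mdiff n f)"
  unfolding mdiff_def
  by (cases n) (auto intro!: cinv_avg cinv_diff intro: cinv_mono[OF cinv_avg])

lemma mdiff_cong_AE:
  assumes "AE x in muG. f x = g x"
    and "f \<in> borel_measurable muG" "g \<in> borel_measurable muG"
  shows "mdiff n f x = mdiff n g x"
  using avg_cong_AE[OF assms] by (simp add: mdiff_def split: nat.split)

lemma mdiff_diff:
  assumes "integrable muG f" "integrable muG g"
  shows "mdiff n (\<lambda>x. f x - g x) x = mdiff n f x - mdiff n g x"
  using avg_diff[OF assms] by (simp add: mdiff_def split: nat.split)

lemma mdiff_mdiff:
  assumes f: "integrable muG f"
  shows "mdiff n (mdiff n f) x = mdiff n f x"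
proof (cases n)
  case 0
  then show ?thesis using avg_avg_le[OF f, of 0 0] by (simp add: mdiff_0[abs_def])
next
  case (Suc k)
  have "mdiff n f = (\<lambda>x. avg (Suc k) f x - avg k f x)" using Suc by (simp add: fun_eq_iff mdiff_Suc)
  then show ?thesis
    using f Suc by (simp add: mdiff_Suc avg_diff integrable_avg avg_avg_le avg_avg_ge)
qed

section \<open>The kernels \<open>kappa n\<close> as differences of normalised cylinder
  indicators\<close>

lemma kappa_Suc: "kappa (Suc k) y = 2 ^ Suc k * indicator (cyl (Suc k)) y - 2 ^ k * indicator (cyl k) y"
  by (auto simp: kappa_def cyl_def indicator_def less_Suc_eq)

lemma kappa_0: "kappa 0 y = indicator (cyl 0) y"
  by (simp add: kappa_def)

lemma bdd_meas_indicator_cyl: "bdd_meas (indicator (cyl k))"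
  by (rule bdd_measI[where B=1]) (auto simp: indicator_def)

lemma bdd_meas_kappa: "bdd_meas (kappa n)"
proof (cases n)
  case 0 then show ?thesis using bdd_meas_indicator_cyl[of 0] by (simp add: kappa_0[abs_def])
next
  case (Suc k) then show ?thesis
    using bdd_meas_indicator_cyl by (simp add: kappa_Suc[abs_def] bdd_meas_diff bdd_meas_mult)
qed

lemma mdiff_conv_kappa:
  assumes f: "integrable muG f"
  shows "mdiff n f x = (\<integral>y. kappa n y * f (cadd x y) \<partial>muG)"
proof (cases n)
  case 0 then show ?thesis by (simp add: mdiff_0 kappa_0 avg_def)
next
  case (Suc k)
  have "(\<integral>y. kappa n y * f (cadd x y) \<partial>muG) =
     (\<integral>y. 2 ^ Suc k * (indicator (cyl (Suc k)) y * f (cadd x y)) - 2 ^ k * (indicator (cyl k) y * f (cadd x y)) \<partial>muG)"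
    unfolding Suc kappa_Suc by (rule Bochner_Integration.integral_cong) (auto simp: algebra_simps)
  also have "\<dots> = mdiff n f x"
    unfolding Suc mdiff_Suc avg_def
    by (subst Bochner_Integration.integral_diff) (auto intro!: integrable_indicator_cyl_cadd f)
  finally show ?thesis by simp
qed

text \<open>Translation by \<open>z\<close> in \<open>cyl k\<close> fixes the first \<open>k\<close>
  coordinates and flips the one at position \<open>k\<close> precisely if \<open>z k\<close>; the
  flip exchanges the values \<open>2 ^ k\<close> and \<open>- (2 ^ k)\<close> that the kernel takes
  on \<open>cyl k\<close>.\<close>

lemma kappa_Suc_cadd:
  assumes "z \<in> cyl k"
  shows "kappa (Suc k) (cadd z y) = (if z k then -1 else 1) * kappa (Suc k) y"
proof -
  have 1: "(\<forall>j<k. \<not> cadd z y j) \<longleftrightarrow> (\<forall>j<k. \<not> y j)" using assms by (auto simp: cyl_def cadd_def)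
  have 2: "cadd z y k \<longleftrightarrow> z k \<noteq> y k" by (simp add: cadd_def)
  show ?thesis unfolding kappa_def less_Suc_eq diff_Suc_1 by (use 1 2 in auto)
qed

text \<open>On the Cantor group a martingale difference only changes sign under translation by the
  last coordinate, so its square is already determined by the previous \<open>\<sigma>\<close>-algebra.\<close>
lemma cinv_mdiff_square:
  assumes f: "integrable muG f"
  shows "cinv (n - 1) (\<lambda>x. (mdiff n f x)\<^sup>2)"
proof (cases n)
  case 0 then show ?thesis using f by (auto intro!: cinv_comp[where h="\<lambda>t. t\<^sup>2"] cinv_mdiff)
next
  case (Suc k)
  have [measurable]: "f \<in> borel_measurable muG" "kappa (Suc k) \<in> borel_measurable muG"
    using f bdd_meas_kappa by auto
  have "(mdiff (Suc k) f (cadd x z))\<^sup>2 = (mdiff (Suc k) f x)\<^sup>2" if z: "z \<in> cyl k" for x z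
  proof -
    have "(\<integral>y. kappa (Suc k) y * f (cadd (cadd x z) y) \<partial>muG)
       = (\<integral>y. kappa (Suc k) (cadd z y) * f (cadd (cadd x z) (cadd z y)) \<partial>muG)"
      by (rule integral_cadd[symmetric]) measurable
    also have "\<dots> = (\<integral>y. (if z k then -1 else 1) * (kappa (Suc k) y * f (cadd x y)) \<partial>muG)"
      by (simp add: kappa_Suc_cadd[OF z] cadd_assoc)
    also have "\<dots> = (if z k then -1 else 1) * (\<integral>y. kappa (Suc k) y * f (cadd x y) \<partial>muG)"
      by simp
    finally show ?thesis by (simp add: mdiff_conv_kappa[OF f])
  qed
  then show ?thesis using Suc by (simp add: cinv_def)
qed

text \<open>Expanding the square, the cross term is rewritten by the martingale property:
  \<open>w x * avg k f x\<close> depends on the first \<open>k\<close> coordinates only, so against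
  it \<open>avg (Suc k) f\<close> may be replaced with \<open>avg k f\<close>.\<close>

lemma integral_mdiff_square:
  assumes f: "integrable muG f" and w: "bdd_meas w" "cinv k w"
  shows "(\<integral>x. w x * (mdiff (Suc k) f x)\<^sup>2 \<partial>muG)
       = (\<integral>x. w x * ((avg (Suc k) f x)\<^sup>2 - (avg k f x)\<^sup>2) \<partial>muG)"
proof -
  have b: "bdd_meas (avg j f)" for j using f by auto
  let ?u = "\<lambda>x. w x * avg k f x"
  have u: "bdd_meas ?u" "cinv k ?u" using w b f by (auto intro!: cinv_mult cinv_avg)
  have "(\<integral>x. ?u x * avg (Suc k) f x \<partial>muG) = (\<integral>x. ?u x * f x \<partial>muG)"
    using u cinv_mono[OF u(2), of "Suc k"] by (intro integral_bdd_mult_avg f) auto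
  also have "\<dots> = (\<integral>x. ?u x * avg k f x \<partial>muG)"
    using u by (intro integral_bdd_mult_avg[symmetric] f)
  finally have eq: "(\<integral>x. ?u x * avg (Suc k) f x \<partial>muG) = (\<integral>x. ?u x * avg k f x \<partial>muG)" .
  have "(\<integral>x. w x * (mdiff (Suc k) f x)\<^sup>2 \<partial>muG) =
     (\<integral>x. w x * ((avg (Suc k) f x)\<^sup>2 - (avg k f x)\<^sup>2) - 2 * (?u x * avg (Suc k) f x - ?u x * avg k f x) \<partial>muG)"
    by (rule Bochner_Integration.integral_cong) (auto simp: mdiff_Suc power2_eq_square algebra_simps)
  also have "\<dots> = (\<integral>x. w x * ((avg (Suc k) f x)\<^sup>2 - (avg k f x)\<^sup>2) \<partial>muG)
      - 2 * ((\<integral>x. ?u x * avg (Suc k) f x \<partial>muG) - (\<integral>x. ?u x * avg k f x \<partial>muG))"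
  proof -
    have i: "integrable muG (\<lambda>x. ?u x * avg j f x)" for j
      using u b by (intro bdd_meas_integrable) auto
    have "integrable muG (\<lambda>x. w x * ((avg (Suc k) f x)\<^sup>2 - (avg k f x)\<^sup>2))"
      by (intro bdd_meas_integrable bdd_meas_mult bdd_meas_diff bdd_meas_power2 w b)
    then show ?thesis using i by (simp)
  qed
  finally show ?thesis using eq by simp
qed

text \<open>Jensen for the square: the value of \<open>avg k f\<close> at the given point is frozen
  as a constant \<open>?c\<close>, and the nonnegative average of the squared deviation of
  \<open>f\<close> from \<open>?c\<close> is expanded.\<close>

lemma avg_square_le:
  assumes f: "integrable muG f" and f2: "integrable muG (\<lambda>x. (f x)\<^sup>2)"
  shows "(avg k f x)\<^sup>2 \<le> avg k (\<lambda>x. (f x)\<^sup>2) x"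
proof -
  let ?c = "avg k f x"
  have "0 \<le> avg k (\<lambda>x. ((f x)\<^sup>2 + ?c\<^sup>2) - (2 * ?c) * f x) x"
    by (rule avg_nonneg) (use sum_squares_ge_zero[of "f _ - ?c" 0] in \<open>auto simp: power2_eq_square algebra_simps\<close>)
  also have "\<dots> = avg k (\<lambda>x. (f x)\<^sup>2) x + ?c\<^sup>2 - (2 * ?c) * ?c"
    using f f2 by (simp add: avg_diff avg_add avg_cmult)
  finally show ?thesis by (simp add: power2_eq_square)
qed

text \<open>The weight is predictable, one level behind the difference. The orthogonality identity
  lets the square of the coarser average be dropped; then Jensen and the invariance of the weight
  pass to \<open>f\<close> itself.\<close>

lemma integral_mdiff_square_le:
  assumes f: "integrable muG f" and f2: "integrable muG (\<lambda>x. (f x)\<^sup>2)"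
    and w: "bdd_meas w" "cinv (n - 1) w" "\<And>x. 0 \<le> w x"
  shows "(\<integral>x. w x * (mdiff n f x)\<^sup>2 \<partial>muG) \<le> (\<integral>x. w x * (f x)\<^sup>2 \<partial>muG)"
proof -
  have wn: "cinv n w" using w(2) by (rule cinv_mono) simp
  have b: "bdd_meas (avg j f)" for j using f by auto
  have "(\<integral>x. w x * (mdiff n f x)\<^sup>2 \<partial>muG) \<le> (\<integral>x. w x * (avg n f x)\<^sup>2 \<partial>muG)"
  proof (cases n)
    case 0 then show ?thesis by (simp add: mdiff_0)
  next
    case (Suc k)
    have "(\<integral>x. w x * (mdiff n f x)\<^sup>2 \<partial>muG) = (\<integral>x. w x * ((avg (Suc k) f x)\<^sup>2 - (avg k f x)\<^sup>2) \<partial>muG)"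
      using integral_mdiff_square[OF f w(1), of k] w Suc by simp
    also have "\<dots> \<le> (\<integral>x. w x * (avg n f x)\<^sup>2 \<partial>muG)"
      unfolding Suc
      by (intro integral_mono bdd_meas_integrable bdd_meas_mult bdd_meas_diff bdd_meas_power2 w b mult_left_mono) auto
    finally show ?thesis .
  qed
  also have "\<dots> \<le> (\<integral>x. w x * avg n (\<lambda>x. (f x)\<^sup>2) x \<partial>muG)"
    using avg_square_le[OF f f2]
    by (intro integral_mono bdd_meas_integrable bdd_meas_mult bdd_meas_power2 bdd_meas_avg w b f2 mult_left_mono)
  also have "\<dots> = (\<integral>x. w x * (f x)\<^sup>2 \<partial>muG)"
    by (rule integral_bdd_mult_avg[OF w(1) wn f2])
  finally show ?thesis .
qed

text \<open>Says that \<open>mdiff n\<close> is a self-adjoint idempotent, which is the source of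
  the orthogonality in \<open>is_orth_proj\<close>. The averages are bounded, so every pairing is
  integrable.\<close>

lemma integral_mdiff_mult_mdiff:
  assumes f: "integrable muG f" and h: "integrable muG h"
  shows "(\<integral>x. f x * mdiff n h x \<partial>muG) = (\<integral>x. mdiff n f x * mdiff n h x \<partial>muG)"
proof -
  have b: "bdd_meas (avg j h)" for j using h by auto
  have bf: "bdd_meas (avg j f)" for j using f by auto
  have c: "cinv k (avg j h)" if "j \<le> k" for j k
    using h that by (auto intro: cinv_mono[OF cinv_avg])
  have base: "(\<integral>x. avg j h x * f x \<partial>muG) = (\<integral>x. avg j h x * avg k f x \<partial>muG)" if "j \<le> k" for j k
    using integral_bdd_mult_avg[OF b c[OF that] f] by simp
  have cf: "(\<integral>x. avg k f x * avg (Suc k) h x \<partial>muG) = (\<integral>x. avg k f x * avg k h x \<partial>muG)" for k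
  proof -
    have 1: "cinv (Suc k) (avg k f)" "cinv k (avg k f)"
      using f by (auto intro: cinv_mono[OF cinv_avg] cinv_avg)
    show ?thesis
      using integral_bdd_mult_avg[OF bf[of k] 1(1) h] integral_bdd_mult_avg[OF bf[of k] 1(2) h] by simp
  qed
  show ?thesis
  proof (cases n)
    case 0 then show ?thesis using base[of 0 0] by (simp add: mdiff_0 mult.commute)
  next
    case (Suc k)
    have i: "integrable muG (\<lambda>x. avg j h x * f x)" for j
      using b f by (rule bdd_meas_mult_integrable)
    have i2: "integrable muG (\<lambda>x. avg j h x * avg l f x)" for j l
      using b bf by (intro bdd_meas_integrable) auto
    have "(\<integral>x. f x * mdiff n h x \<partial>muG) = (\<integral>x. avg (Suc k) h x * f x - avg k h x * f x \<partial>muG)"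
      by (rule Bochner_Integration.integral_cong) (auto simp: Suc mdiff_Suc algebra_simps)
    also have "\<dots> = (\<integral>x. avg (Suc k) h x * avg (Suc k) f x \<partial>muG) - (\<integral>x. avg k h x * avg (Suc k) f x \<partial>muG)"
      using i base[of "Suc k" "Suc k"] base[of k "Suc k"] by simp
    \<comment> \<open>The two added integrals cancel by \<open>cf\<close>; they complete the product
      of the two differences.\<close>
    also have "\<dots> = (\<integral>x. avg (Suc k) h x * avg (Suc k) f x \<partial>muG) - (\<integral>x. avg k h x * avg (Suc k) f x \<partial>muG)
       - (\<integral>x. avg (Suc k) h x * avg k f x \<partial>muG) + (\<integral>x. avg k h x * avg k f x \<partial>muG)"
      using cf[of k] by (simp add: mult.commute)
    also have "\<dots> = (\<integral>x. avg (Suc k) h x * avg (Suc k) f x - avg k h x * avg (Suc k) f x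
       - avg (Suc k) h x * avg k f x + avg k h x * avg k f x \<partial>muG)"
      using i2 by simp
    also have "\<dots> = (\<integral>x. mdiff n f x * mdiff n h x \<partial>muG)"
      by (rule Bochner_Integration.integral_cong) (auto simp: Suc mdiff_Suc algebra_simps)
    finally show ?thesis .
  qed
qed

section \<open>Conditional expectations given the first n coordinates\<close>

lemma Fn_subalgebra: "subalgebra muG (Fn n)"
proof -
  have m: "{x. x j} \<in> sets muG" for j
    using predE[OF measurable_muG_component[of j]] by simp
  have "sigma_sets UNIV ((\<lambda>j. {x. x j}) ` {..<n}) \<subseteq> sets muG"
    using sets.sigma_sets_subset[of "(\<lambda>j. {x. x j}) ` {..<n}" muG] m by auto
  then show ?thesis by (simp add: subalgebra_def Fn_def sets_measure_of_conv space_measure_of_conv)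
qed

lemma cinv_of_Fn_sets:
  assumes "A \<in> sets (Fn n)"
  shows "cinv n (indicator A :: cantor \<Rightarrow> real)"
proof -
  have "A \<in> sigma_sets UNIV ((\<lambda>j. {x. x j}) ` {..<n})"
    using assms by (simp add: Fn_def sets_measure_of_conv)
  then have "\<forall>x. \<forall>y\<in>cyl n. cadd x y \<in> A \<longleftrightarrow> x \<in> A"
  proof induction
    case (Basic a) then show ?case by (auto simp: cyl_def cadd_def)
  qed auto
  then show ?thesis by (simp add: cinv_def indicator_def)
qed

text \<open>An invariant function factors through the map \<open>?t\<close> that erases all
  coordinates from position \<open>n\<close> on. This map has finite range, and preimages of points
  are finite intersections of generators and their complements.\<close>

lemma cinv_measurable_Fn:
  fixes u :: "cantor \<Rightarrow> real"
  assumes u: "cinv n u"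
  shows "u \<in> borel_measurable (Fn n)"
proof -
  let ?t = "\<lambda>x::cantor. \<lambda>j. j < n \<and> x j"
  have sp: "space (Fn n) = UNIV" by (simp add: Fn_def space_measure_of_conv)
  have m: "{x. x j} \<in> sets (Fn n)" if "j < n" for j
    using that by (auto simp: Fn_def sets_measure_of_conv)
  have m': "{x. x j = b} \<in> sets (Fn n)" if "j < n" for j b
    using m[OF that] sets.compl_sets[OF m[OF that]]
    by (cases b) (auto simp: sp Collect_neg_eq Compl_eq_Diff_UNIV)
  have fin: "finite (range ?t)"
  proof (rule finite_subset)
    show "range ?t \<subseteq> (\<lambda>S. \<lambda>j. j \<in> S) ` Pow {..<n}"
    proof safe
      fix x :: cantor
      show "?t x \<in> (\<lambda>S. \<lambda>j. j \<in> S) ` Pow {..<n}"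
        by (rule image_eqI[where x="{j. j < n \<and> x j}"]) auto
    qed
  qed simp
  have "?t \<in> measurable (Fn n) (count_space (range ?t))"
  proof (subst measurable_count_space_eq2[OF fin], safe)
    fix p :: cantor
    have "?t -` {?t p} \<inter> space (Fn n) = (\<Inter>j\<in>{..<n}. {x. x j = p j}) \<inter> space (Fn n)"
      by (auto simp: fun_eq_iff)
    also have "\<dots> \<in> sets (Fn n)"
    \<comment> \<open>For \<open>n = 0\<close> the intersection is indexed by the empty set, and the
      preimage is the whole space.\<close>
    proof (cases "n = 0")
      case False
      then show ?thesis by (intro sets.Int sets.finite_INT) (auto intro: m')
    qed simp
    finally show "?t -` {?t p} \<inter> space (Fn n) \<in> sets (Fn n)" .
  qed (rule rangeI)
  then have "(\<lambda>x. u (?t x)) \<in> borel_measurable (Fn n)"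
    by (rule measurable_compose) simp
  moreover have "u (?t x) = u x" for x
  proof -
    have "(\<lambda>j. \<not> j < n \<and> x j) \<in> cyl n" by (auto simp: cyl_def)
    then have "u (cadd x (\<lambda>j. \<not> j < n \<and> x j)) = u x" using u by (auto simp: cinv_def)
    moreover have "cadd x (\<lambda>j. \<not> j < n \<and> x j) = ?t x" by (auto simp: cadd_def fun_eq_iff)
    ultimately show ?thesis by simp
  qed
  ultimately show ?thesis by simp
qed

text \<open>Verifies the defining property of conditional expectation: indicators of sets in
  \<open>Fn n\<close> are invariant, hence integrate \<open>avg n f\<close> and \<open>f\<close>
  alike.\<close>

lemma real_cond_exp_eq_avg:
  assumes f: "integrable muG f"
  shows "AE x in muG. real_cond_exp muG (Fn n) f x = avg n f x"
proof -
  interpret F: finite_measure_subalgebra muG "Fn n"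
    by standard (rule Fn_subalgebra)
  show ?thesis
  proof (rule F.real_cond_exp_charact)
    fix A assume A: "A \<in> sets (Fn n)"
    then have AM: "A \<in> sets muG" using Fn_subalgebra by (auto simp: subalgebra_def)
    have "bdd_meas (indicator A)" by (rule bdd_measI[where B=1]) (use AM in \<open>auto simp: indicator_def\<close>)
    then show "(\<integral>x\<in>A. f x \<partial>muG) = (\<integral>x\<in>A. avg n f x \<partial>muG)"
      using integral_bdd_mult_avg[OF _ cinv_of_Fn_sets[OF A] f]
      by (simp add: set_lebesgue_integral_def)
  next
    show "avg n f \<in> borel_measurable (Fn n)"
      using f by (intro cinv_measurable_Fn cinv_avg) auto
  qed (use f in auto)
qed

lemma Delta_eq_mdiff:
  assumes f: "integrable muG f"
  shows "AE x in muG. Delta n f x = mdiff n f x"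
proof (cases n)
  case 0
  then show ?thesis using real_cond_exp_eq_avg[OF f, of 0] by (simp add: Delta_def mdiff_0)
next
  case (Suc k)
  then show ?thesis using real_cond_exp_eq_avg[OF f, of k] real_cond_exp_eq_avg[OF f, of "Suc k"]
    by (auto simp: Delta_def mdiff_Suc)
qed

section \<open>The truncated kernel\<close>

definition kappa_top :: "nat \<Rightarrow> real" where
  "kappa_top n = (if n = 0 then 1 else 2 ^ (n - 1))"

text \<open>Removing the ball of radius \<open>r\<close> removes \<open>cyl N\<close>. There
  \<open>kappa n\<close> with \<open>n \<le> N\<close> has the constant value
  \<open>kappa_top n\<close>, which produces a multiple of \<open>avg N\<close>; if
  \<open>n > N\<close>, the support of \<open>kappa n\<close> lies inside \<open>cyl N\<close> and
  nothing is left.\<close>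

lemma trunc_conv_eq:
  assumes f: "integrable muG (\<lambda>x. f x n)"
    and N: "(1/2) ^ Suc N < r" "\<And>m. m < N \<Longrightarrow> r \<le> (1/2) ^ Suc m"
  shows "trunc_conv r f x n = (if n \<le> N then
     mdiff n (\<lambda>x. f x n) x - kappa_top n * (1/2) ^ N * avg N (\<lambda>x. f x n) x else 0)"
proof -
  have r: "0 < r" using N(1) by (meson less_trans zero_less_divide_1_iff zero_less_numeral zero_less_power)
  \<comment> \<open>Distances from \<open>czero\<close> are 0 or \<open>(1/2) ^ Suc L\<close> with
    \<open>L\<close> the first nonzero position, so for nonzero \<open>y\<close> the bounds on
    \<open>r\<close> translate \<open>r \<le> cdist czero y\<close> into
    \<open>L < N\<close>.\<close>
  have ind: "r \<le> cdist czero y \<longleftrightarrow> y \<notin> cyl N" for y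
  proof (cases "y = czero")
    case True
    then show ?thesis using r by (simp add: cdist_def cyl_def czero_def)
  next
    case False
    define L where "L = (LEAST j. czero j \<noteq> y j)"
    have ex: "\<exists>j. czero j \<noteq> y j" using False by (auto simp: fun_eq_iff)
    have L: "y L" using LeastI_ex[OF ex] by (simp add: L_def czero_def)
    have L2: "\<not> y j" if "j < L" for j using not_less_Least[of j "\<lambda>j. czero j \<noteq> y j"] that
      by (simp add: L_def czero_def)
    have cd: "cdist czero y = (1/2) ^ Suc L" using False by (auto simp: cdist_def L_def)
    have "y \<notin> cyl N \<longleftrightarrow> L < N"
      using L L2 by (auto simp: cyl_def) (metis leI le_less_trans)
    moreover have "r \<le> (1/2) ^ Suc L \<longleftrightarrow> L < N"
    proof
      assume "r \<le> (1/2) ^ Suc L"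
      show "L < N"
      proof (rule ccontr)
        assume "\<not> L < N"
        then have "(1/2::real) ^ Suc L \<le> (1/2) ^ Suc N" by (intro power_decreasing) auto
        then show False using N(1) \<open>r \<le> (1/2) ^ Suc L\<close> by linarith
      qed
    qed (use N(2) in auto)
    ultimately show ?thesis unfolding cd by blast
  qed
  have eq: "trunc_conv r f x n = (\<integral>y. kappa n y * f (cadd x y) n - (indicator (cyl N) y * kappa n y) * f (cadd x y) n \<partial>muG)"
    unfolding trunc_conv_def ind
    by (rule Bochner_Integration.integral_cong) (auto simp: indicator_def)
  have i1: "integrable muG (\<lambda>y. kappa n y * f (cadd x y) n)"
    by (rule bdd_meas_mult_integrable[OF bdd_meas_kappa integrable_cadd[OF f]])
  show ?thesis
  proof (cases "n \<le> N")
    case True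
    have k: "indicator (cyl N) y * kappa n y = kappa_top n * indicator (cyl N) y" for y
      using True by (auto simp: kappa_def kappa_top_def cyl_def indicator_def dest: less_le_trans)
    have "trunc_conv r f x n = (\<integral>y. kappa n y * f (cadd x y) n \<partial>muG)
       - (\<integral>y. kappa_top n * (indicator (cyl N) y * f (cadd x y) n) \<partial>muG)"
      unfolding eq k mult.assoc
      by (rule Bochner_Integration.integral_diff[OF i1]) (auto intro!: integrable_indicator_cyl_cadd f)
    then show ?thesis using True
      by (simp add: mdiff_conv_kappa[OF f] avg_def power_one_over)
  next
    case False
    have "kappa n y - indicator (cyl N) y * kappa n y = 0" for y
    proof (cases "y \<in> cyl N")
      case out: False
      then obtain j where "j < N" "y j" by (auto simp: cyl_def)
      then show ?thesis using False by (auto simp: kappa_def)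
    qed simp
    then have "kappa n y * f (cadd x y) n - (indicator (cyl N) y * kappa n y) * f (cadd x y) n = 0" for y
      by (metis left_diff_distrib mult_zero_left)
    then show ?thesis using False unfolding eq by (simp only: if_False Bochner_Integration.integral_zero)
  qed
qed

section \<open>Elementary inequalities and the vector-valued setting\<close>

primrec runmax :: "nat \<Rightarrow> (cantor \<Rightarrow> real) \<Rightarrow> cantor \<Rightarrow> real" where
  "runmax 0 h = avg 0 h"
| "runmax (Suc k) h = (\<lambda>x. max (runmax k h x) (avg (Suc k) h x))"

lemma bdd_meas_max [intro]:
  assumes "bdd_meas u" "bdd_meas v"
  shows "bdd_meas (\<lambda>x. max (u x) (v x))"
proof -
  obtain B C where BC: "\<And>x. \<bar>u x\<bar> \<le> B" "\<And>x. \<bar>v x\<bar> \<le> C" using assms by (auto simp: bdd_meas_def)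
  have "\<bar>max (u x) (v x)\<bar> \<le> max B C" for x
    using BC[of x] by (auto simp: max_def abs_le_iff)
  moreover have "(\<lambda>x. max (u x) (v x)) \<in> borel_measurable muG"
    using assms[THEN bdd_meas_measurable] by measurable
  ultimately show ?thesis by (rule bdd_measI[rotated])
qed

lemma runmax_mono: "j \<le> k \<Longrightarrow> runmax j h x \<le> runmax k h x"
  by (induction rule: dec_induct) auto

lemma avg_le_runmax: "avg k h x \<le> runmax k h x"
  by (cases k) auto

lemma le_runmax_iff: "runmax m h x \<le> t \<longleftrightarrow> (\<forall>k\<le>m. avg k h x \<le> t)"
  by (induction m) (auto simp: le_Suc_eq)

lemma bdd_meas_runmax: "integrable muG h \<Longrightarrow> bdd_meas (runmax k h)"
  by (induction k) (simp_all add: bdd_meas_avg bdd_meas_max)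

lemma cinv_max: "cinv k u \<Longrightarrow> cinv k v \<Longrightarrow> cinv k (\<lambda>x. max (u x) (v x))"
  by (simp add: cinv_def)

lemma cinv_runmax: "h \<in> borel_measurable muG \<Longrightarrow> cinv k (runmax k h)"
proof (induction k)
  case 0 then show ?case by (simp add: cinv_avg)
next
  case (Suc k)
  then show ?case using cinv_mono[of k "runmax k h" "Suc k"] by (auto intro!: cinv_max cinv_avg)
qed

lemma cinv_sum: "(\<And>i. i \<in> I \<Longrightarrow> cinv k (u i)) \<Longrightarrow> cinv k (\<lambda>x. \<Sum>i\<in>I. u i x)"
  by (simp add: cinv_def)

section \<open>Scalar inequalities\<close>

lemma powr_diff_le:
  fixes x y q :: real
  assumes "0 \<le> y" "y \<le> x" "1 \<le> q"
  shows "x powr q - y powr q \<le> q * (x - y) * x powr (q - 1)"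
\<comment> \<open>The derivative formula requires a positive base. Equality and \<open>y = 0\<close>
  are treated by hand, the rest by the mean value theorem and monotonicity of
  \<open>z powr (q - 1)\<close>.\<close>
proof (cases "y = x \<or> y = 0")
  case True
  moreover have "x powr q \<le> q * (x * x powr (q - 1))"
    using assms mult_right_mono[of 1 q "x powr q"] by (cases "x = 0") (auto simp: powr_mult_base)
  ultimately show ?thesis by (auto simp: mult.assoc)
next
  case False
  then have "0 < y" "y < x" using assms by auto
  have "((\<lambda>z. z powr q) has_real_derivative q * z powr (q - 1)) (at z)" if "y \<le> z" for z
    using that \<open>0 < y\<close> by (intro has_real_derivative_powr) simp
  then obtain z where z: "y < z" "z < x" "x powr q - y powr q = (x - y) * (q * z powr (q - 1))"
    using MVT2[of y x "\<lambda>z. z powr q" "\<lambda>z. q * z powr (q - 1)"] \<open>y < x\<close> by auto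
  have "z powr (q - 1) \<le> x powr (q - 1)" using z \<open>0 < y\<close> assms by (intro powr_mono2) auto
  then have "(x - y) * (q * z powr (q - 1)) \<le> (x - y) * (q * x powr (q - 1))"
    using \<open>y < x\<close> assms by (intro mult_left_mono) auto
  then show ?thesis using z by (simp add: algebra_simps)
qed

text \<open>A Young inequality with a crude constant, proved by comparing \<open>a\<close> with
  \<open>e * b\<close>. The free parameter \<open>e\<close> makes the last term small enough to be
  absorbed later.\<close>

lemma mult_powr_le:
  fixes a b q e :: real
  assumes "0 \<le> a" "0 \<le> b" "1 \<le> q" "0 < e"
  shows "a * b powr (q - 1) \<le> (1/e) powr (q - 1) * a powr q + e * b powr q"
proof (cases "a \<le> e * b")
  case True
  have "a * b powr (q - 1) \<le> e * b * b powr (q - 1)" using True by (intro mult_right_mono) auto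
  also have "\<dots> = e * b powr q" using assms by (cases "b = 0") (auto simp: powr_mult_base mult.assoc)
  finally show ?thesis by (simp add: add_increasing)
next
  case False
  then have "b \<le> (1/e) * a" using assms by (simp add: field_simps)
  then have "b powr (q - 1) \<le> ((1/e) * a) powr (q - 1)" using assms by (intro powr_mono2) auto
  also have "\<dots> = (1/e) powr (q - 1) * a powr (q - 1)" by (rule powr_mult)
  finally have "a * b powr (q - 1) \<le> a * ((1/e) powr (q - 1) * a powr (q - 1))"
    using assms by (intro mult_left_mono) auto
  also have "\<dots> = (1/e) powr (q - 1) * a powr q"
    using assms by (cases "a = 0") (auto simp: powr_mult_base)
  finally show ?thesis using assms by (simp add: add_increasing2)
qed

text \<open>Stopping the sequence \<open>F\<close> when it first exceeds \<open>t\<close>: doubling keeps it below \<open>2 * t\<close>.\<close>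
lemma stopped_sums:
  fixes F a M :: "nat \<Rightarrow> real"
  assumes M: "M 0 = F 0" "\<And>k. M (Suc k) = max (M k) (F (Suc k))"
    and F: "\<And>k. 0 \<le> F k" "\<And>k. F (Suc k) \<le> 2 * F k" "F 0 \<le> t"
    and a: "\<And>k. a k \<le> (F k)\<^sup>2"
  defines "w \<equiv> \<lambda>k. of_bool (M k \<le> t)"
  defines "Z \<equiv> \<lambda>m. F 0 + (\<Sum>k<m. w k * (F (Suc k) - F k))"
  defines "S \<equiv> \<lambda>m. a 0 + (\<Sum>k<m. w k * (a (Suc k) - a k))"
  shows "0 \<le> Z m" "M m > t \<Longrightarrow> Z m > t" "S m \<le> 2 * t * Z m"
proof -
  have t: "0 \<le> t" using F(1)[of 0] F(3) by simp
  have sq: "(F k)\<^sup>2 \<le> 2 * t * F k" if "F k \<le> 2 * t" for k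
    using mult_right_mono[OF that F(1)[of k]] by (simp add: power2_eq_square)
  \<comment> \<open>The induction invariant: before the passage both sums telescope to the current
    values. At the passage the value is still at most \<open>2 * t\<close> by doubling, and
    afterwards the zero weights freeze both sums.\<close>
  have "(M m \<le> t \<longrightarrow> Z m = F m \<and> S m = a m \<and> F m \<le> t) \<and> (M m > t \<longrightarrow> Z m > t \<and> S m \<le> 2 * t * Z m)"
  proof (induction m)
    case 0
    then show ?case using F(3) by (simp add: M Z_def S_def)
  next
    case (Suc m)
    have Z: "Z (Suc m) = Z m + w m * (F (Suc m) - F m)" by (simp add: Z_def)
    have S: "S (Suc m) = S m + w m * (a (Suc m) - a m)" by (simp add: S_def)
    show ?case
    proof (cases "M m \<le> t")
      case True
      then have eq: "Z (Suc m) = F (Suc m)" "S (Suc m) = a (Suc m)" "F m \<le> t"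
        using Suc Z S by (auto simp: w_def)
      then have "F (Suc m) \<le> 2 * t" using F(2)[of m] by linarith
      then have "a (Suc m) \<le> 2 * t * F (Suc m)" using sq a order_trans by blast
      then show ?thesis using True eq by (auto simp: M(2))
    next
      case False
      then show ?thesis using Suc Z S by (auto simp: w_def M(2))
    qed
  qed
  moreover have "a m \<le> 2 * t * F m" if "F m \<le> t"
    using sq[of m] that a[of m] t by linarith
  ultimately show "0 \<le> Z m" "M m > t \<Longrightarrow> Z m > t" "S m \<le> 2 * t * Z m"
    using F(1)[of m] t by (force, blast, force)
qed

text \<open>Controls the error of a summation by parts by a telescoping difference. Doubling
  replaces \<open>x\<^sup>2\<close> with \<open>4 * y\<^sup>2\<close>, and
  \<open>2 * x * y \<le> x\<^sup>2 + y\<^sup>2\<close> does the rest.\<close>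

lemma powr_weight_diff_le:
  fixes x y p :: real
  assumes "0 < y" "y \<le> x" "x \<le> 2 * y" "1 \<le> p" "p \<le> 2"
  shows "x\<^sup>2 * (y powr (p - 2) - x powr (p - 2)) \<le> 4 * (x powr p - y powr p)"
proof -
  have sq: "z\<^sup>2 * z powr (p - 2) = z powr p" if "0 < z" for z :: real
    using that by (simp add: powr_diff powr_numeral)
  have x: "0 < x" using assms by simp
  have d: "0 \<le> y powr (p - 2) - x powr (p - 2)"
    using assms by (simp add: powr_mono2')
  have "x\<^sup>2 \<le> 4 * y\<^sup>2" using power_mono[OF assms(3), of 2] x by (simp add: power_mult_distrib)
  then have "x\<^sup>2 * (y powr (p - 2) - x powr (p - 2)) \<le> (4 * y\<^sup>2) * (y powr (p - 2) - x powr (p - 2))"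
    by (rule mult_right_mono) (rule d)
  also have "\<dots> = 4 * (y powr p - y\<^sup>2 * x powr (p - 2))"
    using sq[OF assms(1)] by (simp add: algebra_simps)
  also have "\<dots> \<le> 4 * (x powr p - y powr p)"
  proof -
    have "2 * y powr p = 2 * (y * y powr (p - 1))" using assms by (simp add: powr_mult_base)
    also have "\<dots> \<le> 2 * (y * x powr (p - 1))" using assms by (simp add: powr_mono2)
    also have "\<dots> = (2 * x * y) * x powr (p - 2)" using x powr_mult_base[of x "p - 2"] by simp
    also have "\<dots> \<le> (x\<^sup>2 + y\<^sup>2) * x powr (p - 2)" by (intro mult_right_mono sum_squares_bound) simp
    also have "\<dots> = x powr p + y\<^sup>2 * x powr (p - 2)" using sq[OF x] by (simp add: algebra_simps)
    finally show ?thesis by simp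
  qed
  finally show ?thesis .
qed

text \<open>Summation by parts with the decreasing weights \<open>M k powr (p - 2)\<close>. The
  constant is 4 from \<open>powr_weight_diff_le\<close> plus 1 from the final boundary term.\<close>

lemma weighted_sum_le:
  fixes F a M :: "nat \<Rightarrow> real"
  assumes M: "M 0 = F 0" "\<And>k. M (Suc k) = max (M k) (F (Suc k))"
    and F: "0 < F 0" "\<And>k. 0 \<le> F k" "\<And>k. F (Suc k) \<le> 2 * F k"
    and a: "\<And>k. a k \<le> (F k)\<^sup>2"
    and p: "1 \<le> p" "p \<le> 2"
  shows "M 0 powr (p - 2) * a 0 + (\<Sum>k<m. M k powr (p - 2) * (a (Suc k) - a k)) \<le> 5 * M m powr p"
proof -
  have mono: "M j \<le> M k" if "j \<le> k" for j k using that by (induction rule: dec_induct) (auto simp: M)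
  have pos: "0 < M k" for k using mono[of 0 k] F M by auto
  have FM: "F k \<le> M k" for k by (cases k) (auto simp: M)
  have aM: "a k \<le> (M k)\<^sup>2" for k
    using a[of k] power_mono[OF FM F(2), of k 2] by linarith
  have double: "M (Suc k) \<le> 2 * M k" for k
    using F(3)[of k] FM[of k] pos[of k] by (auto simp: M(2))
  let ?R = "\<lambda>m. M 0 powr (p - 2) * a 0 + (\<Sum>k<m. M k powr (p - 2) * (a (Suc k) - a k))"
  \<comment> \<open>The boundary term is kept in the induction claim, so that only differences of
    weights have to be estimated.\<close>
  have "?R m \<le> M m powr (p - 2) * a m + 4 * M m powr p" for m
  proof (induction m)
    case (Suc m)
    have "a (Suc m) * (M m powr (p - 2) - M (Suc m) powr (p - 2))
        \<le> (M (Suc m))\<^sup>2 * (M m powr (p - 2) - M (Suc m) powr (p - 2))"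
      using mono[of m "Suc m"] pos p by (intro mult_right_mono aM) (simp add: powr_mono2')
    also have "\<dots> \<le> 4 * (M (Suc m) powr p - M m powr p)"
      by (rule powr_weight_diff_le[OF pos mono double p]) simp
    finally show ?case using Suc by (simp add: algebra_simps)
  qed simp
  also have "M m powr (p - 2) * a m \<le> M m powr (p - 2) * (M m)\<^sup>2"
    by (intro mult_left_mono aM) simp
  also have "\<dots> = M m powr p"
    using pos[of m] by (simp add: powr_diff powr_numeral)
  finally show ?thesis by simp
qed

text \<open>Splits at \<open>A = M\<^sup>2\<close>: below it the term \<open>M powr p\<close>
  suffices, above it the nonpositive exponent \<open>p / 2 - 1\<close> lets \<open>M\<close> replace
  the root of \<open>A\<close>. It takes the part of Hoelder's inequality.\<close>

lemma powr_half_le: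
  fixes A M p :: real
  assumes "0 \<le> A" "0 < M" "0 < p" "p \<le> 2"
  shows "A powr (p / 2) \<le> A * M powr (p - 2) + M powr p"
proof (cases "A \<le> M\<^sup>2")
  case True
  have "A powr (p / 2) \<le> (M\<^sup>2) powr (p / 2)" using assms True by (intro powr_mono2) auto
  also have "\<dots> = M powr p" using assms by (simp add: powr_powr flip: powr_numeral)
  finally show ?thesis using assms by (simp add: add_increasing)
next
  case False
  then have A: "0 < A" using assms by (smt (verit) zero_le_power2)
  have "A powr (p / 2) = A * A powr (p / 2 - 1)" using A by (simp add: powr_mult_base)
  also have "A powr (p / 2 - 1) \<le> (M\<^sup>2) powr (p / 2 - 1)"
    using False assms by (intro powr_mono2') auto
  also have "(M\<^sup>2) powr (p / 2 - 1) = M powr (p - 2)"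
    using assms by (simp add: powr_powr algebra_simps flip: powr_numeral)
  finally show ?thesis using A by (simp add: add_increasing2)
qed

text \<open>The majorant \<open>\<phi>\<close> of the l^2 norm is abstract so that the same
  estimates apply to a function and to its tails. Domination is stated by partial sums and almost
  everywhere, whereas \<open>\<phi>\<close> is nonnegative at every point.\<close>

locale ell2_function =
  fixes f :: "cantor \<Rightarrow> nat \<Rightarrow> real" and \<phi> :: "cantor \<Rightarrow> real"
  assumes meas [measurable]: "\<And>n. (\<lambda>x. f x n) \<in> borel_measurable muG"
    and phi_int: "integrable muG \<phi>"
    and phi_nonneg: "\<And>x. 0 \<le> \<phi> x"
    and dominated: "AE x in muG. \<forall>m. (\<Sum>n<m. (f x n)\<^sup>2) \<le> (\<phi> x)\<^sup>2"
begin

lemma phi_meas [measurable]: "\<phi> \<in> borel_measurable muG"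
  using phi_int by auto

lemma coord_le: "AE x in muG. \<bar>f x n\<bar> \<le> \<phi> x"
  using dominated
proof eventually_elim
  case (elim x)
  have "(f x n)\<^sup>2 \<le> (\<Sum>i<Suc n. (f x i)\<^sup>2)" by (simp add: sum_nonneg)
  also have "\<dots> \<le> (\<phi> x)\<^sup>2" using elim by blast
  finally show ?case using phi_nonneg[of x] abs_le_square_iff[of "f x n" "\<phi> x"] by simp
qed

lemma coord_int: "integrable muG (\<lambda>x. f x n)"
  by (rule Bochner_Integration.integrable_bound[OF phi_int]) (use coord_le in \<open>auto simp: phi_nonneg\<close>)

definition energy :: "nat \<Rightarrow> nat \<Rightarrow> cantor \<Rightarrow> real" where
  "energy m k x = (\<Sum>n<m. (avg k (\<lambda>x. f x n) x)\<^sup>2)"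

definition sq :: "nat \<Rightarrow> cantor \<Rightarrow> real" where
  "sq m x = (\<Sum>n<m. (mdiff n (\<lambda>x. f x n) x)\<^sup>2)"

text \<open>The norm of an average is at most the average of the norm, by duality: pairing with the
  fixed vector \<open>c\<close> of averages at \<open>x\<close>, Cauchy-Schwarz under the average
  gives \<open>s * s \<le> s * avg k \<phi> x\<close>.\<close>

lemma energy_le: "energy m k x \<le> (avg k \<phi> x)\<^sup>2"
proof -
  define c where "c n = avg k (\<lambda>x. f x n) x" for n
  define s where "s = sqrt (\<Sum>n<m. (c n)\<^sup>2)"
  have s0: "0 \<le> s" by (simp add: s_def sum_nonneg)
  have s2: "s\<^sup>2 = energy m k x" by (simp add: s_def energy_def c_def sum_nonneg)
  have "energy m k x = (\<Sum>n<m. c n * avg k (\<lambda>x. f x n) x)"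
    by (simp add: energy_def c_def power2_eq_square)
  also have "\<dots> = avg k (\<lambda>y. \<Sum>n<m. c n * f y n) x"
    by (simp add: avg_sum coord_int avg_cmult)
  also have "\<dots> \<le> avg k (\<lambda>y. s * \<phi> y) x"
  proof (rule avg_mono_AE)
    show "AE y in muG. (\<Sum>n<m. c n * f y n) \<le> s * \<phi> y"
      using dominated
    proof eventually_elim
      case (elim y)
      have "(\<Sum>n<m. c n * f y n)\<^sup>2 \<le> (\<Sum>n<m. (c n)\<^sup>2) * (\<Sum>n<m. (f y n)\<^sup>2)"
        by (rule Cauchy_Schwarz_ineq_sum)
      also have "\<dots> \<le> s\<^sup>2 * (\<phi> y)\<^sup>2"
        using elim by (intro mult_mono) (auto simp: s_def sum_nonneg)
      finally have "(\<Sum>n<m. c n * f y n)\<^sup>2 \<le> (s * \<phi> y)\<^sup>2" by (simp add: power_mult_distrib)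
      then show ?case by (rule power2_le_imp_le) (simp add: s0 phi_nonneg)
    qed
  qed (intro Bochner_Integration.integrable_sum integrable_mult_right coord_int phi_int)+
  also have "\<dots> = s * avg k \<phi> x" by (rule avg_cmult)
  finally have "s * s \<le> s * avg k \<phi> x" using s2 by (simp add: power2_eq_square)
  then have "s \<le> avg k \<phi> x" using s0 avg_nonneg[of \<phi> k x] phi_nonneg
    by (cases "s = 0") auto
  then show ?thesis using s0 s2 power_mono[of s "avg k \<phi> x" 2] by simp
qed

lemma bdd_meas_energy: "bdd_meas (energy m k)"
  unfolding energy_def[abs_def] by (intro bdd_meas_sum bdd_meas_power2 bdd_meas_avg coord_int)

lemma bdd_meas_sq: "bdd_meas (sq m)"
  unfolding sq_def[abs_def] by (intro bdd_meas_sum bdd_meas_power2 bdd_meas_mdiff coord_int)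

lemma sq_nonneg: "0 \<le> sq m x"
  by (simp add: sq_def sum_nonneg)

lemma sq_mono: "j \<le> k \<Longrightarrow> sq j x \<le> sq k x"
  unfolding sq_def by (rule sum_mono2) auto

text \<open>Each diagonal difference is one nonnegative term in a sum over all coordinates
  \<open>n < Suc m\<close>, and by weighted orthogonality the integral of that sum is that of an
  increment of \<open>energy\<close>. The weight \<open>w k\<close> sits on the difference of level
  \<open>Suc k\<close>, hence is predictable.\<close>

lemma weighted_sq_le_energy:
  assumes w: "\<And>k. bdd_meas (w k)" "\<And>k. cinv k (w k)" "\<And>k x. 0 \<le> w k x"
  shows "(\<integral>x. w 0 x * (mdiff 0 (\<lambda>x. f x 0) x)\<^sup>2
            + (\<Sum>k<m. w k x * (mdiff (Suc k) (\<lambda>x. f x (Suc k)) x)\<^sup>2) \<partial>muG)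
      \<le> (\<integral>x. w 0 x * energy (Suc m) 0 x
            + (\<Sum>k<m. w k x * (energy (Suc m) (Suc k) x - energy (Suc m) k x)) \<partial>muG)"
proof -
  have d: "integrable muG (\<lambda>x. w j x * (mdiff k (\<lambda>x. f x n) x)\<^sup>2)" for j k n
    by (intro bdd_meas_integrable bdd_meas_mult bdd_meas_power2 bdd_meas_mdiff coord_int w)
  have e: "integrable muG (\<lambda>x. w j x * energy m k x)" for j k m
    by (intro bdd_meas_integrable bdd_meas_mult bdd_meas_energy w)
  have e': "integrable muG (\<lambda>x. w j x * (energy m k x - energy m l x))" for j k l m
    by (intro bdd_meas_integrable bdd_meas_mult bdd_meas_diff bdd_meas_energy w)
  have a: "integrable muG (\<lambda>x. w j x * ((avg k (\<lambda>x. f x n) x)\<^sup>2 - (avg l (\<lambda>x. f x n) x)\<^sup>2))" for j k l n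
    by (intro bdd_meas_integrable bdd_meas_mult bdd_meas_diff bdd_meas_power2 bdd_meas_avg coord_int w)
  have 0: "(\<integral>x. w 0 x * (mdiff 0 (\<lambda>x. f x 0) x)\<^sup>2 \<partial>muG) \<le> (\<integral>x. w 0 x * energy (Suc m) 0 x \<partial>muG)"
    unfolding mdiff_0 energy_def
    by (intro integral_mono d[of 0 0, unfolded mdiff_0] e[unfolded energy_def] mult_left_mono w)
       (use member_le_sum[of 0 "{..<Suc m}" "\<lambda>n. (avg 0 (\<lambda>x. f x n) _)\<^sup>2"] in auto)
  have step: "(\<integral>x. w k x * (mdiff (Suc k) (\<lambda>x. f x (Suc k)) x)\<^sup>2 \<partial>muG)
      \<le> (\<integral>x. w k x * (energy (Suc m) (Suc k) x - energy (Suc m) k x) \<partial>muG)" if "k < m" for k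
  proof -
    have "(\<integral>x. w k x * (mdiff (Suc k) (\<lambda>x. f x (Suc k)) x)\<^sup>2 \<partial>muG)
      \<le> (\<Sum>n<Suc m. \<integral>x. w k x * (mdiff (Suc k) (\<lambda>x. f x n) x)\<^sup>2 \<partial>muG)"
      by (rule member_le_sum[of "Suc k" "{..<Suc m}"]) (use that w in auto)
    also have "\<dots> = (\<Sum>n<Suc m. \<integral>x. w k x * ((avg (Suc k) (\<lambda>x. f x n) x)\<^sup>2 - (avg k (\<lambda>x. f x n) x)\<^sup>2) \<partial>muG)"
      by (intro sum.cong refl integral_mdiff_square coord_int w)
    also have "\<dots> = (\<integral>x. (\<Sum>n<Suc m. w k x * ((avg (Suc k) (\<lambda>x. f x n) x)\<^sup>2 - (avg k (\<lambda>x. f x n) x)\<^sup>2)) \<partial>muG)"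
      by (rule Bochner_Integration.integral_sum[symmetric]) (rule a)
    also have "\<dots> = (\<integral>x. w k x * (energy (Suc m) (Suc k) x - energy (Suc m) k x) \<partial>muG)"
      by (simp only: energy_def sum_subtractf[symmetric] sum_distrib_left)
    finally show ?thesis .
  qed
  show ?thesis
    unfolding Bochner_Integration.integral_add[OF d Bochner_Integration.integrable_sum[OF d]]
      Bochner_Integration.integral_add[OF e Bochner_Integration.integrable_sum[OF e']]
      Bochner_Integration.integral_sum[OF d] Bochner_Integration.integral_sum[OF e']
    by (intro add_mono 0 sum_mono step) simp
qed

end

section \<open>Weak type and strong type estimates\<close>

lemma (in prob_space) markov_real:
  assumes "integrable M u" "\<And>x. 0 \<le> u x" "0 < c"
  shows "c * measure M {x \<in> space M. u x > c} \<le> (\<integral>x. u x \<partial>M)"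
proof -
  have [measurable]: "u \<in> borel_measurable M" using assms by auto
  have "c * measure M {x \<in> space M. u x > c} = (\<integral>x. c * indicator {x \<in> space M. u x > c} x \<partial>M)"
    by simp
  also have "\<dots> \<le> (\<integral>x. u x \<partial>M)"
  proof (rule integral_mono)
    show "integrable M (\<lambda>x. c * indicator {x \<in> space M. u x > c} x)"
      by (intro integrable_mult_right integrable_real_indicator) (auto simp: emeasure_eq_measure)
    show "c * indicator {x \<in> space M. u x > c} x \<le> u x" for x
      using assms(2)[of x] assms(3) by (auto simp: indicator_def)
  qed (rule assms)
  finally show ?thesis .
qed

lemma sets_muG_gt:
  fixes t :: real
  assumes [measurable]: "u \<in> borel_measurable muG"
  shows "{x. t < u x} \<in> sets muG"
proof -
  have "{x \<in> space muG. t < u x} \<in> sets muG" by measurable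
  then show ?thesis by simp
qed

section \<open>Stopped averages and weak type bounds\<close>

context ell2_function
begin

lemma bdd_meas_stop: "bdd_meas (\<lambda>x. of_bool (runmax k \<phi> x \<le> t))"
proof (rule bdd_measI[where B=1])
  have [measurable]: "runmax k \<phi> \<in> borel_measurable muG"
    using bdd_meas_runmax[OF phi_int] by auto
  show "(\<lambda>x. of_bool (runmax k \<phi> x \<le> t) :: real) \<in> borel_measurable muG"
    unfolding of_bool_def by measurable
qed simp

lemma cinv_stop: "cinv k (\<lambda>x. of_bool (runmax k \<phi> x \<le> t) :: real)"
  by (rule cinv_comp[where h="\<lambda>s. of_bool (s \<le> t)"]) (rule cinv_runmax[OF phi_meas])

text \<open>The averages of \<open>\<phi>\<close>, stopped at the first level where they exceed
  \<open>t\<close>: the weights are 1 before the passage and 0 from then on.\<close>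

definition stopped :: "real \<Rightarrow> nat \<Rightarrow> cantor \<Rightarrow> real" where
  "stopped t m x = avg 0 \<phi> x + (\<Sum>k<m. of_bool (runmax k \<phi> x \<le> t) * (avg (Suc k) \<phi> x - avg k \<phi> x))"

lemma bdd_meas_stopped: "bdd_meas (stopped t m)"
  unfolding stopped_def[abs_def]
  by (intro bdd_meas_add bdd_meas_sum bdd_meas_mult bdd_meas_diff bdd_meas_avg bdd_meas_stop phi_int)

text \<open>A martingale transform: increments multiplied by bounded adapted weights integrate to
  zero.\<close>

lemma integral_stopped: "(\<integral>x. stopped t m x \<partial>muG) = (\<integral>x. \<phi> x \<partial>muG)"
proof -
  have i: "integrable muG (\<lambda>x. of_bool (runmax k \<phi> x \<le> t) * avg l \<phi> x)" for k l
    by (intro bdd_meas_integrable bdd_meas_mult bdd_meas_avg bdd_meas_stop phi_int)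
  have z: "(\<integral>x. of_bool (runmax k \<phi> x \<le> t) * (avg (Suc k) \<phi> x - avg k \<phi> x) \<partial>muG) = 0" for k
  proof -
    have "(\<integral>x. of_bool (runmax k \<phi> x \<le> t) * avg (Suc k) \<phi> x \<partial>muG) = (\<integral>x. of_bool (runmax k \<phi> x \<le> t) * avg k \<phi> x \<partial>muG)"
      using integral_bdd_mult_avg[OF bdd_meas_stop cinv_stop phi_int, of k t]
        integral_bdd_mult_avg[OF bdd_meas_stop cinv_mono[OF cinv_stop] phi_int, of k "Suc k" t] by simp
    then show ?thesis using i by (simp add: right_diff_distrib)
  qed
  have i': "integrable muG (\<lambda>x. of_bool (runmax k \<phi> x \<le> t) * (avg l \<phi> x - avg j \<phi> x))" for k l j
    by (intro bdd_meas_integrable bdd_meas_mult bdd_meas_diff bdd_meas_avg bdd_meas_stop phi_int)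
  show ?thesis
    unfolding stopped_def
      Bochner_Integration.integral_add[OF integrable_avg[OF phi_int] Bochner_Integration.integrable_sum[OF i']]
      Bochner_Integration.integral_sum[OF i'] z
    by (simp add: integral_avg phi_int)
qed

lemma avg_phi_nonneg: "0 \<le> avg k \<phi> x"
  by (rule avg_nonneg) (rule phi_nonneg)

lemma avg_phi_Suc_le: "avg (Suc k) \<phi> x \<le> 2 * avg k \<phi> x"
  by (rule avg_Suc_le[OF phi_int phi_nonneg])

lemma integral_phi_nonneg: "0 \<le> (\<integral>x. \<phi> x \<partial>muG)"
  by (simp add: phi_nonneg)

text \<open>Pointwise applications of \<open>stopped_sums\<close>; the assumption is its starting
  condition, because the level 0 average equals the integral.\<close>

lemma
  assumes "(\<integral>x. \<phi> x \<partial>muG) \<le> t"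
  shows stopped_nonneg: "0 \<le> stopped t m x"
    and stopped_gt: "t < runmax m \<phi> x \<Longrightarrow> t < stopped t m x"
    and stopped_energy: "energy j 0 x + (\<Sum>k<m. of_bool (runmax k \<phi> x \<le> t) * (energy j (Suc k) x - energy j k x))
       \<le> 2 * t * stopped t m x"
proof -
  have t: "avg 0 \<phi> x \<le> t" using assms by (simp add: avg_0)
  show "0 \<le> stopped t m x" "t < runmax m \<phi> x \<Longrightarrow> t < stopped t m x"
    "energy j 0 x + (\<Sum>k<m. of_bool (runmax k \<phi> x \<le> t) * (energy j (Suc k) x - energy j k x))
       \<le> 2 * t * stopped t m x"
    using stopped_sums[of "\<lambda>k. runmax k \<phi> x" "\<lambda>k. avg k \<phi> x" t "\<lambda>k. energy j k x" m]
      avg_phi_nonneg[of _ x] avg_phi_Suc_le[of _ x] t energy_le[of j _ x]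
    by (simp_all add: stopped_def)
qed

text \<open>When the integral is at most \<open>t\<close>, Markov's inequality is applied to the
  stopped averages, whose integral is known; otherwise the claim is trivial in a probability
  space.\<close>

lemma weak_type_runmax:
  assumes t: "0 < t"
  shows "t * measure muG {x. t < runmax m \<phi> x} \<le> (\<integral>x. \<phi> x \<partial>muG)"
proof (cases "(\<integral>x. \<phi> x \<partial>muG) \<le> t")
  case True
  have [measurable]: "stopped t m \<in> borel_measurable muG" using bdd_meas_stopped by auto
  have "t * measure muG {x. t < runmax m \<phi> x} \<le> t * measure muG {x \<in> space muG. stopped t m x > t}"
    using t stopped_gt[OF True] by (intro mult_left_mono muG.finite_measure_mono) (auto intro: sets_muG_gt)
  also have "\<dots> \<le> (\<integral>x. stopped t m x \<partial>muG)"
    by (intro muG.markov_real bdd_meas_integrable bdd_meas_stopped stopped_nonneg True t)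
  finally show ?thesis by (simp add: integral_stopped)
next
  case False
  moreover have "t * measure muG {x. t < runmax m \<phi> x} \<le> t * 1"
    using t by (intro mult_left_mono) auto
  ultimately show ?thesis using integral_phi_nonneg by linarith
qed

text \<open>Outside the set where the running maximum exceeds \<open>t\<close>, all weights equal 1
  and the weighted sum \<open>W\<close> is \<open>sq (Suc m)\<close>. The constant is 1 from the
  maximal function plus 2 from Markov's inequality for \<open>W\<close>.\<close>

lemma weak_type_sq:
  assumes t: "0 < t"
  shows "t * measure muG {x. t\<^sup>2 < sq m x} \<le> 3 * (\<integral>x. \<phi> x \<partial>muG)"
proof (cases "(\<integral>x. \<phi> x \<partial>muG) \<le> t")
  case True
  define w where "w k x = (of_bool (runmax k \<phi> x \<le> t) :: real)" for k x
  define W where "W x = w 0 x * (mdiff 0 (\<lambda>x. f x 0) x)\<^sup>2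
            + (\<Sum>k<m. w k x * (mdiff (Suc k) (\<lambda>x. f x (Suc k)) x)\<^sup>2)" for x
  have w: "bdd_meas (w k)" "cinv k (w k)" "0 \<le> w k x" for k x
    using bdd_meas_stop cinv_stop by (simp_all add: w_def[abs_def])
  have w0: "w 0 x = 1" for x using True by (simp add: w_def avg_0)
  have bW: "bdd_meas W"
    unfolding W_def[abs_def]
    by (intro bdd_meas_add bdd_meas_sum bdd_meas_mult bdd_meas_power2 bdd_meas_mdiff w coord_int)
  have [measurable]: "W \<in> borel_measurable muG" "runmax m \<phi> \<in> borel_measurable muG"
    using bW bdd_meas_runmax[OF phi_int] by auto
  have "(\<integral>x. W x \<partial>muG) \<le> (\<integral>x. w 0 x * energy (Suc m) 0 x
            + (\<Sum>k<m. w k x * (energy (Suc m) (Suc k) x - energy (Suc m) k x)) \<partial>muG)"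
    unfolding W_def by (rule weighted_sq_le_energy[OF w])
  also have "\<dots> \<le> (\<integral>x. 2 * t * stopped t m x \<partial>muG)"
  proof (intro integral_mono bdd_meas_integrable)
    fix x
    show "w 0 x * energy (Suc m) 0 x + (\<Sum>k<m. w k x * (energy (Suc m) (Suc k) x - energy (Suc m) k x))
       \<le> 2 * t * stopped t m x"
      using stopped_energy[OF True, of "Suc m" x m] unfolding w0 by (simp add: w_def)
  qed (intro bdd_meas_add bdd_meas_sum bdd_meas_mult bdd_meas_diff bdd_meas_energy bdd_meas_stopped bdd_meas_const w)+
  also have "\<dots> = 2 * t * (\<integral>x. \<phi> x \<partial>muG)" by (simp add: integral_stopped)
  finally have IW: "(\<integral>x. W x \<partial>muG) \<le> 2 * t * (\<integral>x. \<phi> x \<partial>muG)" .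
  have "t\<^sup>2 * measure muG {x \<in> space muG. W x > t\<^sup>2} \<le> (\<integral>x. W x \<partial>muG)"
    using t w(3) by (intro muG.markov_real bdd_meas_integrable bW) (auto simp: W_def intro!: add_nonneg_nonneg sum_nonneg)
  with IW have "t * (t * measure muG {x. t\<^sup>2 < W x}) \<le> t * (2 * (\<integral>x. \<phi> x \<partial>muG))"
    by (simp add: power2_eq_square algebra_simps)
  then have mW: "t * measure muG {x. t\<^sup>2 < W x} \<le> 2 * (\<integral>x. \<phi> x \<partial>muG)" using t by simp
  have sub: "{x. t\<^sup>2 < sq m x} \<subseteq> {x. t < runmax m \<phi> x} \<union> {x. t\<^sup>2 < W x}"
  proof safe
    fix x assume 1: "t\<^sup>2 < sq m x" and "\<not> t\<^sup>2 < W x"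
    show "t < runmax m \<phi> x"
    proof (rule ccontr)
      assume "\<not> t < runmax m \<phi> x"
      then have "w k x = 1" if "k \<le> m" for k
        using runmax_mono[OF that, of \<phi> x] by (simp add: w_def)
      then have "W x = sq (Suc m) x"
        unfolding W_def sq_def sum.lessThan_Suc_shift by simp
      then show False using 1 \<open>\<not> t\<^sup>2 < W x\<close> sq_mono[of m "Suc m" x] by simp
    qed
  qed
  have "{x. t < runmax m \<phi> x} \<in> sets muG" "{x. t\<^sup>2 < W x} \<in> sets muG"
    by (simp_all add: sets_muG_gt)
  then have "measure muG {x. t\<^sup>2 < sq m x} \<le> measure muG {x. t < runmax m \<phi> x} + measure muG {x. t\<^sup>2 < W x}"
    using muG.finite_measure_mono[OF sub] measure_Un_le[of "{x. t < runmax m \<phi> x}" muG "{x. t\<^sup>2 < W x}"]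
    by (meson order_trans sets.Un)
  then have "t * measure muG {x. t\<^sup>2 < sq m x} \<le> t * measure muG {x. t < runmax m \<phi> x} + t * measure muG {x. t\<^sup>2 < W x}"
    using t by (simp flip: distrib_left)
  then show ?thesis using mW weak_type_runmax[OF t, of m] by linarith
next
  case False
  moreover have "t * measure muG {x. t\<^sup>2 < sq m x} \<le> t * 1"
    using t by (intro mult_left_mono) auto
  ultimately show ?thesis using integral_phi_nonneg by linarith
qed

section \<open>L^p bounds for running maxima and square functions\<close>

lemma runmax_phi_nonneg: "0 \<le> runmax m \<phi> x"
  using avg_phi_nonneg[of m x] avg_le_runmax[of m \<phi> x] by linarith

text \<open>A chain rule expresses the power of the maximum through increments of \<open>?u\<close>.
  Powers of the running maximum are adapted, so averages may be replaced by \<open>\<phi>\<close>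
  and the sum telescopes. Boundedness of the averages makes the left side finite, so half of it can
  be absorbed.\<close>

lemma doob:
  assumes p: "1 < p" and int: "integrable muG (\<lambda>x. \<phi> x powr p)"
  defines "q \<equiv> p / (p - 1)"
  shows "(\<integral>x. runmax m \<phi> x powr p \<partial>muG) \<le> 2 * q * (2 * q) powr (p - 1) * (\<integral>x. \<phi> x powr p \<partial>muG)"
proof -
  let ?M = "\<lambda>k x. runmax k \<phi> x"
  let ?u = "\<lambda>k x. ?M k x powr (p - 1)"
  have q: "1 \<le> q" "0 < q" "(p - 1) * q = p" "(p - 1) * (q - 1) = 1" using p by (auto simp: q_def field_simps)
  have bM: "bdd_meas (?M k)" for k by (rule bdd_meas_runmax[OF phi_int])
  have bu: "bdd_meas (?u k)" for k using p by (intro bdd_meas_powr bM runmax_phi_nonneg) simp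
  have cu: "cinv j (?u k)" if "k \<le> j" for j k
    by (rule cinv_mono[OF _ that], rule cinv_comp[where h="\<lambda>s. s powr (p - 1)"]) (rule cinv_runmax[OF phi_meas])
  \<comment> \<open>The chain rule is applied to the powers \<open>x powr (p - 1)\<close> with
    exponent \<open>q\<close>, using \<open>(p - 1) * q = p\<close> and
    \<open>(p - 1) * (q - 1) = 1\<close>.\<close>
  have pw: "x powr p - y powr p \<le> q * x * (x powr (p - 1) - y powr (p - 1))" if "0 \<le> y" "y \<le> x" for x y :: real
  proof -
    have "(x powr (p - 1)) powr q - (y powr (p - 1)) powr q
      \<le> q * (x powr (p - 1) - y powr (p - 1)) * (x powr (p - 1)) powr (q - 1)"
      using that p q by (intro powr_diff_le powr_mono2) auto
    then show ?thesis using that q by (simp add: powr_powr mult_ac)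
  qed
  \<comment> \<open>The maximum increases only at a level where it equals the current average, so
    this average may stand in front of each increment.\<close>
  have pt: "?M m x powr p \<le> q * (avg 0 \<phi> x * ?u 0 x + (\<Sum>k<m. avg (Suc k) \<phi> x * (?u (Suc k) x - ?u k x)))" for m x
  proof (induction m)
    case 0
    have "avg 0 \<phi> x powr p = avg 0 \<phi> x * avg 0 \<phi> x powr (p - 1)"
      using avg_phi_nonneg[of 0 x] by (cases "avg 0 \<phi> x = 0") (auto simp: powr_mult_base)
    also have "\<dots> \<le> q * (avg 0 \<phi> x * avg 0 \<phi> x powr (p - 1))"
      using q mult_right_mono[of 1 q "avg 0 \<phi> x * avg 0 \<phi> x powr (p - 1)"] avg_phi_nonneg[of 0 x] by simp
    finally show ?case by simp
  next
    case (Suc m)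
    have "?M (Suc m) x powr p - ?M m x powr p \<le> q * (avg (Suc m) \<phi> x * (?u (Suc m) x - ?u m x))"
    proof (cases "?M m x \<le> avg (Suc m) \<phi> x")
      case True
      then have "?M (Suc m) x = avg (Suc m) \<phi> x" by simp
      then show ?thesis using pw[OF runmax_phi_nonneg True] by (simp add: mult_ac)
    next
      case False
      then have "?M (Suc m) x = ?M m x" by simp
      then show ?thesis by simp
    qed
    then show ?case using Suc by (simp add: distrib_left)
  qed
  have i1: "integrable muG (\<lambda>x. ?u k x * \<phi> x)" for k
    by (intro bdd_meas_mult_integrable bu phi_int)
  have i2: "integrable muG (\<lambda>x. avg j \<phi> x * (?u k x - ?u l x))" for j k l
    by (intro bdd_meas_integrable bdd_meas_mult bdd_meas_diff bdd_meas_avg phi_int bu)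
  have i3: "integrable muG (\<lambda>x. avg j \<phi> x * ?u k x)" for j k
    by (intro bdd_meas_integrable bdd_meas_mult bdd_meas_avg phi_int bu)
  have iM: "integrable muG (\<lambda>x. ?M m x powr p)"
    using p by (intro bdd_meas_integrable bdd_meas_powr bM runmax_phi_nonneg) simp
  have e1: "(\<integral>x. avg j \<phi> x * ?u k x \<partial>muG) = (\<integral>x. ?u k x * \<phi> x \<partial>muG)" if "k \<le> j" for j k
    using integral_bdd_mult_avg[OF bu cu[OF that] phi_int] by (simp add: mult.commute)
  have e2: "(\<integral>x. avg (Suc k) \<phi> x * (?u (Suc k) x - ?u k x) \<partial>muG)
     = (\<integral>x. ?u (Suc k) x * \<phi> x \<partial>muG) - (\<integral>x. ?u k x * \<phi> x \<partial>muG)" for k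
    unfolding right_diff_distrib Bochner_Integration.integral_diff[OF i3 i3]
    by (simp only: e1 le_refl le_SucI)
  have "(\<integral>x. ?M m x powr p \<partial>muG) \<le> (\<integral>x. q * (avg 0 \<phi> x * ?u 0 x + (\<Sum>k<m. avg (Suc k) \<phi> x * (?u (Suc k) x - ?u k x))) \<partial>muG)"
    by (intro integral_mono iM pt integrable_mult_right Bochner_Integration.integrable_add
          Bochner_Integration.integrable_sum i2 i3)
  also have "\<dots> = q * ((\<integral>x. ?u 0 x * \<phi> x \<partial>muG) + (\<Sum>k<m. (\<integral>x. ?u (Suc k) x * \<phi> x \<partial>muG) - (\<integral>x. ?u k x * \<phi> x \<partial>muG)))"
    unfolding integral_mult_right_zero
      Bochner_Integration.integral_add[OF i3 Bochner_Integration.integrable_sum[OF i2]]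
      Bochner_Integration.integral_sum[OF i2] e2
    by (simp only: e1 le_refl)
  also have "\<dots> = q * (\<integral>x. \<phi> x * ?u m x \<partial>muG)"
    unfolding sum_lessThan_telescope[of "\<lambda>k. \<integral>x. ?u k x * \<phi> x \<partial>muG" m] by (simp add: mult.commute)
  \<comment> \<open>Young with \<open>e = 1 / (2 * q)\<close>: after multiplication by
    \<open>q\<close> exactly half of the left side returns.\<close>
  also have "\<dots> \<le> q * (\<integral>x. (1 / (1 / (2 * q))) powr (p - 1) * \<phi> x powr p + 1 / (2 * q) * ?M m x powr p \<partial>muG)"
  proof (intro mult_left_mono integral_mono)
    show "integrable muG (\<lambda>x. \<phi> x * ?u m x)" using i1[of m] by (simp add: mult.commute)
    show "integrable muG (\<lambda>x. (1 / (1 / (2 * q))) powr (p - 1) * \<phi> x powr p + 1 / (2 * q) * ?M m x powr p)"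
      by (intro Bochner_Integration.integrable_add integrable_mult_right int iM)
    show "\<phi> x * ?u m x \<le> (1 / (1 / (2 * q))) powr (p - 1) * \<phi> x powr p + 1 / (2 * q) * ?M m x powr p" for x
      using p q by (intro mult_powr_le phi_nonneg runmax_phi_nonneg) auto
  qed (use q in simp)
  also have "\<dots> = q * (2 * q) powr (p - 1) * (\<integral>x. \<phi> x powr p \<partial>muG) + 1 / 2 * (\<integral>x. ?M m x powr p \<partial>muG)"
    using q by (simp add: int iM algebra_simps)
  finally show ?thesis by simp
qed

lemma sum_square_dominated: "AE x in muG. (\<Sum>n<m. (f x n)\<^sup>2) \<le> (\<phi> x)\<^sup>2"
  using dominated by eventually_elim blast

text \<open>The chain rule turns the power into a sum with weights
  \<open>sq (Suc k) x powr (q - 1)\<close>. They contain the current difference, yet are predictable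
  by \<open>cinv_mdiff_square\<close>, so \<open>integral_mdiff_square_le\<close> applies.\<close>

lemma sq_Lp_ge2:
  assumes p: "2 \<le> p" and int: "integrable muG (\<lambda>x. \<phi> x powr p)"
  shows "(\<integral>x. sq m x powr (p / 2) \<partial>muG) \<le> p * p powr (p / 2 - 1) * (\<integral>x. \<phi> x powr p \<partial>muG)"
proof -
  define q where "q = p / 2"
  have q: "1 \<le> q" "0 < q" using p by (auto simp: q_def)
  let ?u = "\<lambda>k x. sq k x powr (q - 1)"
  have bu: "bdd_meas (?u k)" for k using q by (intro bdd_meas_powr bdd_meas_sq sq_nonneg) simp
  \<comment> \<open>\<open>sq (Suc k)\<close> involves differences up to index \<open>k\<close>
    only, whose squares are determined one level earlier.\<close>
  have cu: "cinv (k - 1) (?u (Suc k))" for k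
    unfolding sq_def
    by (rule cinv_comp[where h="\<lambda>s. s powr (q - 1)"], rule cinv_sum)
       (rule cinv_mono[OF cinv_mdiff_square[OF coord_int]], auto)
  have phi_sq: "(\<phi> x)\<^sup>2 powr q = \<phi> x powr p" for x
    using phi_nonneg[of x] by (cases "\<phi> x = 0") (auto simp: q_def powr_powr simp flip: powr_numeral)
  have i_phi2: "integrable muG (\<lambda>x. (\<phi> x)\<^sup>2)"
  proof (rule Bochner_Integration.integrable_bound)
    show "integrable muG (\<lambda>x. 1 + \<phi> x powr p)" using int by simp
    show "AE x in muG. norm ((\<phi> x)\<^sup>2) \<le> norm (1 + \<phi> x powr p)"
    proof (rule AE_I2)
      fix x
      have "(\<phi> x)\<^sup>2 \<le> 1 + \<phi> x powr p"
      proof (cases "\<phi> x \<le> 1")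
        case True
        then have "(\<phi> x)\<^sup>2 \<le> 1" using phi_nonneg[of x] by (simp add: power_le_one)
        then show ?thesis by (simp add: add_increasing2)
      next
        case False
        then have "\<phi> x powr 2 \<le> \<phi> x powr p" using p by (intro powr_mono) auto
        then show ?thesis using False by simp
      qed
      then show "norm ((\<phi> x)\<^sup>2) \<le> norm (1 + \<phi> x powr p)" by simp
    qed
  qed measurable
  have i_f2: "integrable muG (\<lambda>x. (f x n)\<^sup>2)" for n
  proof (rule Bochner_Integration.integrable_bound[OF i_phi2])
    show "AE x in muG. norm ((f x n)\<^sup>2) \<le> norm ((\<phi> x)\<^sup>2)"
      using coord_le[of n] by eventually_elim (simp add: phi_nonneg flip: abs_le_square_iff)
  qed measurable
  have i_sq: "integrable muG (\<lambda>x. sq m x powr q)"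
    using q by (intro bdd_meas_integrable bdd_meas_powr bdd_meas_sq sq_nonneg) simp
  have pt: "sq m x powr q \<le> q * (\<Sum>k<m. ?u (Suc k) x * (mdiff k (\<lambda>x. f x k) x)\<^sup>2)" for m x
  proof (induction m)
    case 0 then show ?case by (simp add: sq_def)
  next
    case (Suc m)
    have "sq (Suc m) x powr q - sq m x powr q \<le> q * (sq (Suc m) x - sq m x) * ?u (Suc m) x"
      by (intro powr_diff_le sq_nonneg sq_mono q) simp
    also have "sq (Suc m) x - sq m x = (mdiff m (\<lambda>x. f x m) x)\<^sup>2" by (simp add: sq_def)
    finally show ?case using Suc by (simp add: algebra_simps)
  qed
  have i1: "integrable muG (\<lambda>x. ?u j x * (mdiff k (\<lambda>x. f x k) x)\<^sup>2)" for j k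
    by (intro bdd_meas_integrable bdd_meas_mult bdd_meas_power2 bdd_meas_mdiff coord_int bu)
  have i2: "integrable muG (\<lambda>x. ?u j x * (f x k)\<^sup>2)" for j k
    by (intro bdd_meas_mult_integrable bu i_f2)
  have i3: "integrable muG (\<lambda>x. ?u j x * (\<phi> x)\<^sup>2)" for j
    by (intro bdd_meas_mult_integrable bu i_phi2)
  have "(\<integral>x. sq m x powr q \<partial>muG) \<le> (\<integral>x. q * (\<Sum>k<m. ?u (Suc k) x * (mdiff k (\<lambda>x. f x k) x)\<^sup>2) \<partial>muG)"
    by (intro integral_mono i_sq pt integrable_mult_right Bochner_Integration.integrable_sum i1)
  also have "\<dots> = q * (\<Sum>k<m. \<integral>x. ?u (Suc k) x * (mdiff k (\<lambda>x. f x k) x)\<^sup>2 \<partial>muG)"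
    unfolding integral_mult_right_zero Bochner_Integration.integral_sum[OF i1] ..
  also have "\<dots> \<le> q * (\<Sum>k<m. \<integral>x. ?u m x * (f x k)\<^sup>2 \<partial>muG)"
  proof (intro mult_left_mono sum_mono)
    fix k assume k: "k \<in> {..<m}"
    have "(\<integral>x. ?u (Suc k) x * (mdiff k (\<lambda>x. f x k) x)\<^sup>2 \<partial>muG) \<le> (\<integral>x. ?u (Suc k) x * (f x k)\<^sup>2 \<partial>muG)"
      by (rule integral_mdiff_square_le[OF coord_int i_f2 bu cu]) simp
    also have "\<dots> \<le> (\<integral>x. ?u m x * (f x k)\<^sup>2 \<partial>muG)"
      using k q by (intro integral_mono i2 mult_right_mono powr_mono2 sq_nonneg sq_mono) auto
    finally show "(\<integral>x. ?u (Suc k) x * (mdiff k (\<lambda>x. f x k) x)\<^sup>2 \<partial>muG) \<le> (\<integral>x. ?u m x * (f x k)\<^sup>2 \<partial>muG)" .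
  qed (use q in simp)
  also have "\<dots> = q * (\<integral>x. (\<Sum>k<m. ?u m x * (f x k)\<^sup>2) \<partial>muG)"
    unfolding Bochner_Integration.integral_sum[OF i2] ..
  also have "\<dots> \<le> q * (\<integral>x. (\<phi> x)\<^sup>2 * ?u m x \<partial>muG)"
  proof (intro mult_left_mono integral_mono_AE Bochner_Integration.integrable_sum i2)
    show "AE x in muG. (\<Sum>k<m. ?u m x * (f x k)\<^sup>2) \<le> (\<phi> x)\<^sup>2 * ?u m x"
      using sum_square_dominated[of m]
    proof eventually_elim
      case (elim x)
      then show ?case
        using mult_left_mono[OF elim, of "?u m x"] by (simp add: sum_distrib_left mult.commute)
    qed
    show "integrable muG (\<lambda>x. (\<phi> x)\<^sup>2 * ?u m x)" using i3[of m] by (simp add: mult.commute)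
  qed (use q in simp)
  \<comment> \<open>Again half of the left side is absorbed, its finiteness being
    \<open>i_sq\<close>; with \<open>2 * q = p\<close> the constant takes the stated form.\<close>
  also have "\<dots> \<le> q * (\<integral>x. (1 / (1 / (2 * q))) powr (q - 1) * (\<phi> x)\<^sup>2 powr q + 1 / (2 * q) * sq m x powr q \<partial>muG)"
  proof (intro mult_left_mono integral_mono)
    show "integrable muG (\<lambda>x. (\<phi> x)\<^sup>2 * ?u m x)" using i3[of m] by (simp add: mult.commute)
    show "integrable muG (\<lambda>x. (1 / (1 / (2 * q))) powr (q - 1) * (\<phi> x)\<^sup>2 powr q + 1 / (2 * q) * sq m x powr q)"
      unfolding phi_sq by (intro Bochner_Integration.integrable_add integrable_mult_right int i_sq)
    show "(\<phi> x)\<^sup>2 * ?u m x \<le> (1 / (1 / (2 * q))) powr (q - 1) * (\<phi> x)\<^sup>2 powr q + 1 / (2 * q) * sq m x powr q" for x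
      using q by (intro mult_powr_le sq_nonneg) auto
  qed (use q in simp)
  also have "\<dots> = q * (2 * q) powr (q - 1) * (\<integral>x. \<phi> x powr p \<partial>muG) + 1 / 2 * (\<integral>x. sq m x powr q \<partial>muG)"
    using q by (simp add: phi_sq int i_sq algebra_simps)
  finally show ?thesis by (simp add: q_def)
qed

text \<open>The weights are the powers \<open>p - 2\<close> of the running maxima;
  \<open>weighted_sum_le\<close> contributes the factor 5 and \<open>powr_half_le\<close> one
  more.\<close>

lemma sq_Lp_le2:
  assumes p: "1 < p" "p \<le> 2"
  shows "(\<integral>x. sq m x powr (p / 2) \<partial>muG) \<le> 6 * (\<integral>x. runmax m \<phi> x powr p \<partial>muG)"
\<comment> \<open>If \<open>\<phi>\<close> vanishes almost everywhere, all differences vanish. The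
  case is separated to keep negative powers away from zero.\<close>
proof (cases "(\<integral>x. \<phi> x \<partial>muG) = 0")
  case True
  have "AE x in muG. \<phi> x = 0" using True phi_int phi_nonneg by (simp add: integral_nonneg_eq_0_iff_AE)
  then have f0: "AE x in muG. f x n = 0" for n
    using coord_le[of n] by eventually_elim simp
  have "mdiff n (\<lambda>x. f x n) x = 0" for n x
  proof -
    have "mdiff n (\<lambda>x. f x n) x = mdiff n (\<lambda>_. 0) x"
      using f0[of n] by (intro mdiff_cong_AE) auto
    then show ?thesis by (simp add: mdiff_def split: nat.split)
  qed
  then have "sq m x = 0" for x by (simp add: sq_def)
  then show ?thesis by simp
next
  case False
  let ?M = "\<lambda>k x. runmax k \<phi> x"
  define c where "c = (\<integral>x. \<phi> x \<partial>muG)"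
  have c: "0 < c" using False integral_phi_nonneg by (simp add: c_def)
  have c0: "avg 0 \<phi> x = c" for x by (simp add: avg_0 c_def)
  \<comment> \<open>The level 0 average is a positive constant below all running maxima, which
    bounds the weights.\<close>
  have Mc: "c \<le> ?M k x" for k x using runmax_mono[of 0 k \<phi> x] by (simp add: c0)
  have Mpos: "0 < ?M k x" for k x using Mc[of k x] c by linarith
  define w where "w k x = ?M k x powr (p - 2)" for k x
  have bM: "bdd_meas (?M k)" for k by (rule bdd_meas_runmax[OF phi_int])
  have [measurable]: "runmax k \<phi> \<in> borel_measurable muG" for k using bM by auto
  have w: "bdd_meas (w k)" "cinv k (w k)" "0 \<le> w k x" for k x
  proof -
    show "bdd_meas (w k)"
    proof (rule bdd_measI)
      show "w k \<in> borel_measurable muG" unfolding w_def[abs_def] by measurable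
      show "\<bar>w k x\<bar> \<le> c powr (p - 2)" for x
        using p c Mc by (simp add: w_def powr_mono2')
    qed
    show "cinv k (w k)" unfolding w_def[abs_def]
      by (rule cinv_comp[where h="\<lambda>s. s powr (p - 2)"]) (rule cinv_runmax[OF phi_meas])
  qed (simp add: w_def)
  have i_M: "integrable muG (\<lambda>x. ?M m x powr p)"
    using p by (intro bdd_meas_integrable bdd_meas_powr bM runmax_phi_nonneg) simp
  define W where "W x = w 0 x * (mdiff 0 (\<lambda>x. f x 0) x)\<^sup>2
            + (\<Sum>k<m. w k x * (mdiff (Suc k) (\<lambda>x. f x (Suc k)) x)\<^sup>2)" for x
  have bW: "bdd_meas W"
    unfolding W_def[abs_def]
    by (intro bdd_meas_add bdd_meas_sum bdd_meas_mult bdd_meas_power2 bdd_meas_mdiff w coord_int)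
  have "(\<integral>x. W x \<partial>muG) \<le> (\<integral>x. w 0 x * energy (Suc m) 0 x
            + (\<Sum>k<m. w k x * (energy (Suc m) (Suc k) x - energy (Suc m) k x)) \<partial>muG)"
    unfolding W_def by (rule weighted_sq_le_energy[OF w])
  also have "\<dots> \<le> (\<integral>x. 5 * ?M m x powr p \<partial>muG)"
  proof (rule integral_mono)
    show "integrable muG (\<lambda>x. w 0 x * energy (Suc m) 0 x + (\<Sum>k<m. w k x * (energy (Suc m) (Suc k) x - energy (Suc m) k x)))"
      by (intro bdd_meas_integrable bdd_meas_add bdd_meas_sum bdd_meas_mult bdd_meas_diff bdd_meas_energy w)
    show "integrable muG (\<lambda>x. 5 * ?M m x powr p)" using i_M by simp
    show "w 0 x * energy (Suc m) 0 x + (\<Sum>k<m. w k x * (energy (Suc m) (Suc k) x - energy (Suc m) k x))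
       \<le> 5 * ?M m x powr p" for x
      unfolding w_def
      by (rule weighted_sum_le[where F="\<lambda>k. avg k \<phi> x"])
         (use c c0 avg_phi_nonneg avg_phi_Suc_le energy_le p in auto)
  qed
  finally have IW: "(\<integral>x. W x \<partial>muG) \<le> 5 * (\<integral>x. ?M m x powr p \<partial>muG)" by simp
  \<comment> \<open>The exponent \<open>p - 2\<close> is nonpositive, so the last running maximum
    gives the smallest weight.\<close>
  have sqW: "sq m x * ?M m x powr (p - 2) \<le> W x" for x
  proof -
    have wm: "?M m x powr (p - 2) \<le> w k x" if "k \<le> m" for k
      using runmax_mono[OF that, of \<phi> x] Mpos[of k x] p by (simp add: w_def powr_mono2')
    have "sq m x * ?M m x powr (p - 2) \<le> sq (Suc m) x * ?M m x powr (p - 2)"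
      by (intro mult_right_mono sq_mono) auto
    also have "\<dots> = ?M m x powr (p - 2) * (mdiff 0 (\<lambda>x. f x 0) x)\<^sup>2
       + (\<Sum>k<m. ?M m x powr (p - 2) * (mdiff (Suc k) (\<lambda>x. f x (Suc k)) x)\<^sup>2)"
      unfolding sq_def sum.lessThan_Suc_shift by (simp only: distrib_left sum_distrib_left mult.commute[of _ "?M m x powr (p - 2)"])
    also have "\<dots> \<le> W x" unfolding W_def
      by (intro add_mono sum_mono mult_right_mono wm) auto
    finally show ?thesis .
  qed
  have "(\<integral>x. sq m x powr (p / 2) \<partial>muG) \<le> (\<integral>x. W x + ?M m x powr p \<partial>muG)"
  proof (rule integral_mono)
    show "integrable muG (\<lambda>x. sq m x powr (p / 2))"
      using p by (intro bdd_meas_integrable bdd_meas_powr bdd_meas_sq sq_nonneg) simp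
    show "integrable muG (\<lambda>x. W x + ?M m x powr p)" using bdd_meas_integrable[OF bW] i_M by simp
    show "sq m x powr (p / 2) \<le> W x + ?M m x powr p" for x
      using powr_half_le[OF sq_nonneg Mpos, of p m x m x] p sqW[of x] by linarith
  qed
  also have "\<dots> = (\<integral>x. W x \<partial>muG) + (\<integral>x. ?M m x powr p \<partial>muG)"
    using bdd_meas_integrable[OF bW] i_M by simp
  finally show ?thesis using IW by simp
qed

end

text \<open>Below 2 this is 6 times the constant in \<open>doob\<close>.\<close>

definition Lp_bound :: "real \<Rightarrow> real" where
  "Lp_bound p = (if 2 \<le> p then p * p powr (p / 2 - 1)
     else 12 * (p / (p - 1)) * (2 * (p / (p - 1))) powr (p - 1))"

lemma Lp_bound_pos: "1 < p \<Longrightarrow> 0 < Lp_bound p"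
  by (simp add: Lp_bound_def)

lemma (in ell2_function) sq_Lp:
  assumes p: "1 < p" and int: "integrable muG (\<lambda>x. \<phi> x powr p)"
  shows "(\<integral>x. sq m x powr (p / 2) \<partial>muG) \<le> Lp_bound p * (\<integral>x. \<phi> x powr p \<partial>muG)"
proof (cases "2 \<le> p")
  case True
  then show ?thesis using sq_Lp_ge2[OF True int] by (simp add: Lp_bound_def)
next
  case False
  then show ?thesis using sq_Lp_le2[OF p, of m] doob[OF p int, of m] by (simp add: Lp_bound_def)
qed

section \<open>Principal values\<close>

lemma measure_UN_incseq_le:
  assumes "\<And>m. B m \<in> sets muG" "incseq B" "\<And>m. t * measure muG (B m) \<le> K"
  shows "t * measure muG (\<Union>m. B m) \<le> K"
proof -
  have "(\<lambda>m. measure muG (B m)) \<longlonglongrightarrow> measure muG (\<Union>m. B m)"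
    using assms by (intro muG.finite_Lim_measure_incseq) auto
  then have "(\<lambda>m. t * measure muG (B m)) \<longlonglongrightarrow> t * measure muG (\<Union>m. B m)"
    by (rule tendsto_mult_left)
  then show ?thesis by (rule LIMSEQ_le_const2) (use assms in auto)
qed

text \<open>Turns measure bounds into an almost everywhere statement: a point of every
  \<open>B j\<close> lies in an intersection of measure 0.\<close>

lemma AE_ex_notin:
  assumes B: "\<And>j::nat. B j \<in> sets muG" and lim: "(\<lambda>j. measure muG (B j)) \<longlonglongrightarrow> 0"
  shows "AE x in muG. \<exists>j. x \<notin> B j"
proof -
  have I: "(\<Inter>j. B j) \<in> sets muG" using B by auto
  have "measure muG (\<Inter>j. B j) \<le> measure muG (B j)" for j
    using B by (intro muG.finite_measure_mono) auto
  then have "measure muG (\<Inter>j. B j) \<le> 0"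
    using lim by (intro LIMSEQ_le_const[OF lim]) auto
  then have "measure muG (\<Inter>j. B j) = 0" by (simp add: measure_le_0_iff)
  then have "(\<Inter>j. B j) \<in> null_sets muG"
    using I by (simp add: muG.emeasure_eq_measure null_sets_def)
  then show ?thesis by (rule AE_I') auto
qed

lemma measure_le_imp_tendsto_0:
  assumes "\<And>j::nat. real (Suc j) * measure muG (B j) \<le> K"
  shows "(\<lambda>j. measure muG (B j)) \<longlonglongrightarrow> 0"
proof (rule tendsto_sandwich[where f="\<lambda>_. 0"])
  show "(\<lambda>j. K * (1 / real (Suc j))) \<longlonglongrightarrow> 0"
    using tendsto_mult_left[OF LIMSEQ_Suc[OF lim_1_over_n], of K] by simp
  show "\<forall>\<^sub>F j in sequentially. measure muG (B j) \<le> K * (1 / real (Suc j))"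
    using assms by (intro always_eventually allI) (simp add: field_simps)
qed auto

context ell2_function
begin

lemma weak_type_maximal:
  assumes t: "0 < t"
  shows "t * measure muG {x. \<exists>k. t < avg k \<phi> x} \<le> (\<integral>x. \<phi> x \<partial>muG)"
proof -
  have eq: "{x. \<exists>k. t < avg k \<phi> x} = (\<Union>m. {x. t < runmax m \<phi> x})"
  proof safe
    fix x k assume "t < avg k \<phi> x"
    then show "x \<in> (\<Union>m. {x. t < runmax m \<phi> x})" using avg_le_runmax[of k \<phi> x] by (auto intro: less_le_trans)
  next
    fix x m assume "t < runmax m \<phi> x"
    then show "\<exists>k. t < avg k \<phi> x" using le_runmax_iff[of m \<phi> x t] by (meson not_le)
  qed
  show ?thesis unfolding eq
  proof (rule measure_UN_incseq_le)
    show "incseq (\<lambda>m. {x. t < runmax m \<phi> x})"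
      using runmax_mono[of _ _ \<phi>] by (fastforce simp: incseq_def intro: less_le_trans)
    show "{x. t < runmax m \<phi> x} \<in> sets muG" for m
      using bdd_meas_runmax[OF phi_int] by (intro sets_muG_gt) auto
  qed (rule weak_type_runmax[OF t])
qed

lemma sets_sq_gt: "{x. c < sq m x} \<in> sets muG"
  using bdd_meas_sq by (intro sets_muG_gt) auto

lemma sets_sup_sq_gt: "{x. \<exists>m. c < sq m x} \<in> sets muG"
proof -
  have "{x. \<exists>m. c < sq m x} = (\<Union>m. {x. c < sq m x})" by auto
  then show ?thesis using sets_sq_gt by auto
qed

lemma weak_type_sup_sq:
  assumes t: "0 < t"
  shows "t * measure muG {x. \<exists>m. t\<^sup>2 < sq m x} \<le> 3 * (\<integral>x. \<phi> x \<partial>muG)"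
proof -
  have "t * measure muG (\<Union>m. {x. t\<^sup>2 < sq m x}) \<le> 3 * (\<integral>x. \<phi> x \<partial>muG)"
  proof (rule measure_UN_incseq_le)
    show "incseq (\<lambda>m. {x. t\<^sup>2 < sq m x})"
      using sq_mono by (fastforce simp: incseq_def intro: less_le_trans)
  qed (rule sets_sq_gt, rule weak_type_sq[OF t])
  moreover have "(\<Union>m. {x. t\<^sup>2 < sq m x}) = {x. \<exists>m. t\<^sup>2 < sq m x}" by auto
  ultimately show ?thesis by simp
qed

text \<open>By the weak type bound at the levels \<open>Suc j\<close>, the partial sums at almost
  every point stay below some level.\<close>

lemma AE_summable_mdiff: "AE x in muG. summable (\<lambda>n. (mdiff n (\<lambda>x. f x n) x)\<^sup>2)"
proof -
  have "AE x in muG. \<exists>j. x \<notin> {x. \<exists>m. (real (Suc j))\<^sup>2 < sq m x}"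
    by (rule AE_ex_notin[OF sets_sup_sq_gt measure_le_imp_tendsto_0[OF weak_type_sup_sq]]) simp
  then show ?thesis
  proof eventually_elim
    case (elim x)
    then obtain c where "\<And>m. sq m x \<le> c" by (auto simp: not_less)
    then show ?case
      by (intro summableI_nonneg_bounded[where x=c]) (auto simp: sq_def)
  qed
qed

end

text \<open>The factor cancels the normalisation, leaving integrals over the shrinking sets
  \<open>cyl N\<close>, whose intersection is null. Dominated convergence works at each point
  \<open>x\<close>.\<close>

lemma half_power_avg_tendsto_0:
  assumes f: "integrable muG f"
  shows "(\<lambda>N. (1/2) ^ N * avg N f x) \<longlonglongrightarrow> 0"
proof -
  have [measurable]: "f \<in> borel_measurable muG" using f by auto
  have "AE y in muG. \<exists>N. y \<notin> cyl N"
    by (rule AE_ex_notin) (auto simp: measure_cyl intro!: LIMSEQ_power_zero)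
  then have AE: "AE y in muG. (\<lambda>N. indicator (cyl N) y * f (cadd x y)) \<longlonglongrightarrow> 0"
  proof eventually_elim
    case (elim y)
    then obtain N where "y \<notin> cyl N" by blast
    then have "indicator (cyl k) y * f (cadd x y) = 0" if "N \<le> k" for k
      using cyl_antimono[OF that] by (auto simp: indicator_def)
    then show ?case by (intro tendsto_eventually) (auto simp: eventually_sequentially)
  qed
  have "(\<lambda>N. \<integral>y. indicator (cyl N) y * f (cadd x y) \<partial>muG) \<longlonglongrightarrow> (\<integral>y. 0 \<partial>muG)"
  proof (rule integral_dominated_convergence[where w="\<lambda>y. \<bar>f (cadd x y)\<bar>"])
    show "integrable muG (\<lambda>y. \<bar>f (cadd x y)\<bar>)" using integrable_cadd[OF f] by simp
    show "AE y in muG. norm (indicator (cyl N) y * f (cadd x y)) \<le> \<bar>f (cadd x y)\<bar>" for N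
      by (auto simp: indicator_def)
  qed (use AE in auto)
  moreover have "(1/2) ^ N * avg N f x = (\<integral>y. indicator (cyl N) y * f (cadd x y) \<partial>muG)" for N
    by (simp add: avg_def power_one_over)
  ultimately show ?thesis by simp
qed

section \<open>Convergence of truncated convolutions at a point\<close>

definition trunc_level :: "real \<Rightarrow> nat" where
  "trunc_level r = (LEAST N. (1/2) ^ Suc N < r)"

lemma trunc_level:
  assumes "0 < r"
  shows "(1/2) ^ Suc (trunc_level r) < r" "\<And>m. m < trunc_level r \<Longrightarrow> r \<le> (1/2) ^ Suc m"
proof -
  obtain n where "(1/2::real) ^ n < r" using real_arch_pow_inv[OF assms, of "1/2"] by auto
  then have "(1/2) ^ Suc n < r" using assms by (auto intro: le_less_trans[rotated])
  then show "(1/2) ^ Suc (trunc_level r) < r" unfolding trunc_level_def by (rule LeastI)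
  show "r \<le> (1/2) ^ Suc m" if "m < trunc_level r" for m
    using not_less_Least[OF that[unfolded trunc_level_def]] by simp
qed

lemma filterlim_trunc_level: "filterlim trunc_level at_top (at_right 0)"
  unfolding filterlim_at_top
proof
  fix K :: nat
  have "K \<le> trunc_level r" if "0 < r" "r < (1/2) ^ K" for r
  proof (rule ccontr)
    assume "\<not> K \<le> trunc_level r"
    then have "(1/2::real) ^ K \<le> (1/2) ^ Suc (trunc_level r)" by (intro power_decreasing) auto
    then show False using trunc_level(1)[OF that(1)] that(2) by linarith
  qed
  then show "\<forall>\<^sub>F r in at_right 0. K \<le> trunc_level r"
    by (intro eventually_at_rightI[of 0 "(1/2) ^ K"]) auto
qed

definition tail :: "nat \<Rightarrow> (nat \<Rightarrow> real) \<Rightarrow> nat \<Rightarrow> real" where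
  "tail m v n = (if n < m then 0 else v n)"

lemma kappa_top_le: "n \<le> N \<Longrightarrow> kappa_top n * (1/2) ^ N \<le> 1" "0 \<le> kappa_top n"
proof -
  assume "n \<le> N"
  have "kappa_top n \<le> 2 ^ n" by (auto simp: kappa_top_def)
  also have "\<dots> \<le> 2 ^ N" using \<open>n \<le> N\<close> by (intro power_increasing) auto
  finally show "kappa_top n * (1/2) ^ N \<le> 1" by (simp add: power_one_over)
qed (simp add: kappa_top_def)

text \<open>At level \<open>N\<close> the error consists of the corrections \<open>b N n\<close> for
  \<open>n \<le> N\<close> and of the missing values \<open>d n\<close> for \<open>n > N\<close>.
  The latter form the tail of a convergent series; the former are controlled by the assumption
  \<open>tails\<close>, uniform in the level.\<close>

lemma pv_conv_mdiff:
  assumes f: "\<And>n. integrable muG (\<lambda>x. f x n)"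
    and s: "summable (\<lambda>n. (mdiff n (\<lambda>x. f x n) x)\<^sup>2)"
    and tails: "\<And>e. 0 < e \<Longrightarrow> \<exists>m. \<forall>M N. (\<Sum>n<M. (avg N (\<lambda>x. tail m (f x) n) x)\<^sup>2) \<le> e"
  shows "pv_conv f x (\<lambda>n. mdiff n (\<lambda>x. f x n) x)"
proof -
  define d where "d n = mdiff n (\<lambda>x. f x n) x" for n
  define b where "b N n = kappa_top n * (1/2) ^ N * avg N (\<lambda>x. f x n) x" for N n
  define err where "err N n = (if n \<le> N then (b N n)\<^sup>2 else (d n)\<^sup>2)" for N n
  have s: "summable (\<lambda>n. (d n)\<^sup>2)" using s by (simp add: d_def)
  have serr: "summable (err N)" for N
    by (rule summable_comparison_test_ev[OF _ s])
       (auto simp: err_def eventually_sequentially intro!: exI[of _ "Suc N"])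
  \<comment> \<open>Finitely many coordinates tend to zero one by one. The others are at most
    averages of the tail of \<open>f\<close>, since
    \<open>kappa_top n * (1/2) ^ N \<le> 1\<close>.\<close>
  have G: "(\<lambda>N. \<Sum>n<Suc N. (b N n)\<^sup>2) \<longlonglongrightarrow> 0"
  proof (rule tendstoI)
    fix e :: real assume e: "0 < e"
    obtain m where m: "\<And>M N. (\<Sum>n<M. (avg N (\<lambda>x. tail m (f x) n) x)\<^sup>2) \<le> e / 2"
      using tails[of "e / 2"] e by auto
    have b0: "(\<lambda>N. b N n) \<longlonglongrightarrow> 0" for n
      using tendsto_mult_left[OF half_power_avg_tendsto_0[OF f], of "kappa_top n" n x]
      by (simp add: b_def mult.assoc)
    have "(\<lambda>N. \<Sum>n<m. (b N n)\<^sup>2) \<longlonglongrightarrow> (\<Sum>n<m. 0\<^sup>2)"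
      by (intro tendsto_sum tendsto_power b0)
    then have "\<forall>\<^sub>F N in sequentially. (\<Sum>n<m. (b N n)\<^sup>2) < e / 2"
      using e by (intro order_tendstoD) auto
    then show "\<forall>\<^sub>F N in sequentially. dist (\<Sum>n<Suc N. (b N n)\<^sup>2) 0 < e"
    proof eventually_elim
      case (elim N)
      have b_le: "(b N n)\<^sup>2 \<le> (avg N (\<lambda>x. tail m (f x) n) x)\<^sup>2" if "n \<le> N" "\<not> n < m" for n
      proof -
        have "\<bar>b N n\<bar> = (kappa_top n * (1/2) ^ N) * \<bar>avg N (\<lambda>x. f x n) x\<bar>"
          using kappa_top_le(2)[of n] by (simp add: b_def abs_mult)
        also have "\<dots> \<le> 1 * \<bar>avg N (\<lambda>x. f x n) x\<bar>"
          using kappa_top_le(1)[OF that(1)] by (intro mult_right_mono) auto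
        finally show ?thesis using that by (simp add: tail_def abs_le_square_iff)
      qed
      have "(\<Sum>n<Suc N. (b N n)\<^sup>2) = (\<Sum>n\<in>{..<Suc N} \<inter> {..<m}. (b N n)\<^sup>2) + (\<Sum>n\<in>{..<Suc N} - {..<m}. (b N n)\<^sup>2)"
        by (rule sum.Int_Diff) simp
      also have "(\<Sum>n\<in>{..<Suc N} \<inter> {..<m}. (b N n)\<^sup>2) \<le> (\<Sum>n<m. (b N n)\<^sup>2)"
        by (rule sum_mono2) auto
      also have "(\<Sum>n\<in>{..<Suc N} - {..<m}. (b N n)\<^sup>2) \<le> (\<Sum>n\<in>{..<Suc N} - {..<m}. (avg N (\<lambda>x. tail m (f x) n) x)\<^sup>2)"
        by (rule sum_mono) (auto intro: b_le)
      also have "\<dots> \<le> (\<Sum>n<Suc N. (avg N (\<lambda>x. tail m (f x) n) x)\<^sup>2)"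
        by (rule sum_mono2) auto
      also have "\<dots> \<le> e / 2" by (rule m)
      finally show ?case using elim by (simp add: sum_nonneg del: sum.lessThan_Suc)
    qed
  qed
  have T: "(\<lambda>N. \<Sum>n. (d (n + Suc N))\<^sup>2) \<longlonglongrightarrow> 0"
  proof -
    have "(\<lambda>N. (\<Sum>n. (d n)\<^sup>2) - (\<Sum>n<N. (d n)\<^sup>2)) \<longlonglongrightarrow> (\<Sum>n. (d n)\<^sup>2) - (\<Sum>n. (d n)\<^sup>2)"
      by (intro tendsto_diff tendsto_const summable_LIMSEQ s)
    then have "(\<lambda>N. \<Sum>n. (d (n + N))\<^sup>2) \<longlonglongrightarrow> 0"
      by (simp add: suminf_minus_initial_segment[OF s])
    then show ?thesis by (rule LIMSEQ_Suc)
  qed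
  have "suminf (err N) = (\<Sum>n. (d (n + Suc N))\<^sup>2) + (\<Sum>n<Suc N. (b N n)\<^sup>2)" for N
    using suminf_split_initial_segment[OF serr, of N "Suc N"] by (simp add: err_def)
  then have "(\<lambda>N. suminf (err N)) \<longlonglongrightarrow> 0"
    using tendsto_add[OF T G] by simp
  then have lim: "(\<lambda>N. ennreal (suminf (err N))) \<longlonglongrightarrow> 0"
    using tendsto_ennrealI by fastforce
  \<comment> \<open>Truncations depend on \<open>r\<close> only through its dyadic level, so the
    limit over radii becomes a limit over levels.\<close>
  have eq: "(\<Sum>n. ennreal ((trunc_conv r f x n - d n)\<^sup>2)) = ennreal (suminf (err (trunc_level r)))" if "0 < r" for r
  proof -
    have "(trunc_conv r f x n - d n)\<^sup>2 = err (trunc_level r) n" for n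
      using trunc_conv_eq[of f n, OF f trunc_level[OF that], of x] by (simp add: err_def d_def b_def)
    moreover have "0 \<le> err N n" for N n by (simp add: err_def)
    ultimately show ?thesis by (simp add: suminf_ennreal2 serr)
  qed
  have "((\<lambda>r. ennreal (suminf (err (trunc_level r)))) \<longlongrightarrow> 0) (at_right 0)"
    by (rule filterlim_compose[OF lim filterlim_trunc_level])
  then show ?thesis unfolding pv_conv_def d_def[symmetric]
    by (rule Lim_transform_eventually)
       (rule eventually_at_rightI[of 0 1], rule eq[symmetric], simp_all)
qed

section \<open>The l^2 norm and L^p functions\<close>

lemma l2norm_nonneg: "summable (\<lambda>n. (v n)\<^sup>2) \<Longrightarrow> 0 \<le> l2norm v"
  by (simp add: l2norm_def suminf_nonneg)

lemma l2norm_square: "summable (\<lambda>n. (v n)\<^sup>2) \<Longrightarrow> (l2norm v)\<^sup>2 = (\<Sum>n. (v n)\<^sup>2)"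
  by (simp add: l2norm_def suminf_nonneg)

lemma borel_measurable_l2norm [measurable (raw)]:
  assumes [measurable]: "\<And>n. (\<lambda>x. f x n) \<in> borel_measurable M"
  shows "(\<lambda>x. l2norm (f x)) \<in> borel_measurable M"
  unfolding l2norm_def by measurable

text \<open>The absolute value matters only on a null set: where the squares are not summable the
  value of the series is unspecified, while the majorant has to be nonnegative everywhere.\<close>

lemma ell2_functionI:
  assumes "\<And>n. (\<lambda>x. f x n) \<in> borel_measurable muG" "AE x in muG. summable (\<lambda>n. (f x n)\<^sup>2)"
    and "integrable muG (\<lambda>x. \<bar>l2norm (f x)\<bar>)"
  shows "ell2_function f (\<lambda>x. \<bar>l2norm (f x)\<bar>)"
proof
  show "AE x in muG. \<forall>m. (\<Sum>n<m. (f x n)\<^sup>2) \<le> \<bar>l2norm (f x)\<bar>\<^sup>2"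
    using assms(2) by eventually_elim (simp add: l2norm_square sum_le_suminf)
qed (use assms in auto)

lemma inLp_integrable:
  assumes f: "inLp p f" and p: "0 < p"
  shows "integrable muG (\<lambda>x. \<bar>l2norm (f x)\<bar> powr p)"
    and "(\<integral>\<^sup>+ x. ennreal (l2norm (f x) powr p) \<partial>muG) = ennreal (\<integral>x. \<bar>l2norm (f x)\<bar> powr p \<partial>muG)"
proof -
  have [measurable]: "\<And>n. (\<lambda>x. f x n) \<in> borel_measurable muG"
    and s: "AE x in muG. summable (\<lambda>n. (f x n)\<^sup>2)"
    and fin: "(\<integral>\<^sup>+ x. ennreal (l2norm (f x) powr p) \<partial>muG) < \<infinity>"
    using f by (auto simp: inLp_def)
  have eq: "(\<integral>\<^sup>+ x. ennreal (l2norm (f x) powr p) \<partial>muG) = (\<integral>\<^sup>+ x. ennreal (\<bar>l2norm (f x)\<bar> powr p) \<partial>muG)"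
    by (rule nn_integral_cong_AE) (use s in eventually_elim, simp add: l2norm_nonneg)
  show 1: "integrable muG (\<lambda>x. \<bar>l2norm (f x)\<bar> powr p)"
    by (rule integrableI_nonneg) (use fin eq in auto)
  show "(\<integral>\<^sup>+ x. ennreal (l2norm (f x) powr p) \<partial>muG) = ennreal (\<integral>x. \<bar>l2norm (f x)\<bar> powr p \<partial>muG)"
    unfolding eq by (rule nn_integral_eq_integral[OF 1]) auto
qed

lemma powr_le_one_add: "0 \<le> a \<Longrightarrow> 1 \<le> p \<Longrightarrow> a \<le> 1 + a powr p" for a p :: real
  using powr_mono[of 1 p a] by (cases "a \<le> 1") (auto simp: add_increasing2)

lemma inLp_integrable_norm:
  assumes f: "inLp p f" and p: "1 \<le> p"
  shows "integrable muG (\<lambda>x. \<bar>l2norm (f x)\<bar>)"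
proof (rule Bochner_Integration.integrable_bound)
  have [measurable]: "\<And>n. (\<lambda>x. f x n) \<in> borel_measurable muG" using f by (auto simp: inLp_def)
  show "integrable muG (\<lambda>x. 1 + \<bar>l2norm (f x)\<bar> powr p)"
    using inLp_integrable(1)[OF f] p by simp
  show "(\<lambda>x. \<bar>l2norm (f x)\<bar>) \<in> borel_measurable muG" by measurable
  show "AE x in muG. norm \<bar>l2norm (f x)\<bar> \<le> norm (1 + \<bar>l2norm (f x)\<bar> powr p)"
    using powr_le_one_add[OF _ p] by auto
qed

lemma inLp_ell2_function:
  assumes f: "inLp p f" and p: "1 \<le> p"
  shows "ell2_function f (\<lambda>x. \<bar>l2norm (f x)\<bar>)"
  using f inLp_integrable_norm[OF f p] by (intro ell2_functionI) (auto simp: inLp_def)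

section \<open>Almost everywhere convergence from small tails\<close>

lemma summable_tail: "summable (\<lambda>n. (v n)\<^sup>2) \<Longrightarrow> summable (\<lambda>n. (tail m v n)\<^sup>2)"
  by (rule summable_comparison_test[of _ "\<lambda>n. (v n)\<^sup>2"]) (auto simp: tail_def)

lemma l2norm_tail:
  assumes "summable (\<lambda>n. (v n)\<^sup>2)"
  shows "l2norm (tail m v) = sqrt ((\<Sum>n. (v n)\<^sup>2) - (\<Sum>n<m. (v n)\<^sup>2))"
proof -
  have "(\<Sum>n. (tail m v n)\<^sup>2) = (\<Sum>n. (v (n + m))\<^sup>2)"
    using suminf_split_initial_segment[OF summable_tail[OF assms], of m m] by (simp add: tail_def)
  then show ?thesis by (simp add: l2norm_def suminf_minus_initial_segment[OF assms])
qed

text \<open>The norms \<open>h m\<close> of the tails tend to 0 in L^1, so by the weak type maximal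
  inequality their maximal functions tend to 0 in measure. \<open>energy_le\<close> converts this
  into the uniform smallness that \<open>pv_conv_mdiff\<close> requires.\<close>

lemma AE_pv_conv_mdiff:
  assumes f: "inLp p f" and p: "1 \<le> p"
  shows "AE x in muG. pv_conv f x (\<lambda>n. mdiff n (\<lambda>x. f x n) x)"
proof -
  interpret ell2_function f "\<lambda>x. \<bar>l2norm (f x)\<bar>" by (rule inLp_ell2_function[OF f p])
  have s: "AE x in muG. summable (\<lambda>n. (f x n)\<^sup>2)" using f by (auto simp: inLp_def)
  define h where "h m x = \<bar>l2norm (tail m (f x))\<bar>" for m x
  have mt [measurable]: "(\<lambda>x. tail m (f x) n) \<in> borel_measurable muG" for m n by (simp add: tail_def)
  have mh [measurable]: "h m \<in> borel_measurable muG" for m unfolding h_def[abs_def] by measurable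
  have h_le: "AE x in muG. norm (h m x) \<le> \<bar>l2norm (f x)\<bar>" for m
    using s
  proof eventually_elim
    case (elim x)
    have "l2norm (tail m (f x)) \<le> l2norm (f x)"
      unfolding l2norm_tail[OF elim] by (simp add: l2norm_def sum_nonneg)
    then show ?case using l2norm_nonneg[OF elim] l2norm_nonneg[OF summable_tail[OF elim], of m] by (simp add: h_def)
  qed
  have h_int: "integrable muG (h m)" for m
    by (rule Bochner_Integration.integrable_bound[OF phi_int mh]) (use h_le in auto)
  have h_lim: "(\<lambda>m. \<integral>x. h m x \<partial>muG) \<longlonglongrightarrow> (\<integral>x. 0 \<partial>muG)"
  proof (rule integral_dominated_convergence[OF _ mh phi_int])
    show "AE x in muG. (\<lambda>m. h m x) \<longlonglongrightarrow> 0"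
      using s
    proof eventually_elim
      case (elim x)
      have "(\<lambda>m. \<bar>sqrt ((\<Sum>n. (f x n)\<^sup>2) - (\<Sum>n<m. (f x n)\<^sup>2))\<bar>) \<longlonglongrightarrow> \<bar>sqrt ((\<Sum>n. (f x n)\<^sup>2) - (\<Sum>n. (f x n)\<^sup>2))\<bar>"
        by (intro tendsto_rabs tendsto_real_sqrt tendsto_diff tendsto_const summable_LIMSEQ elim)
      then show ?case by (simp add: h_def l2norm_tail[OF elim])
    qed
  qed (use h_le in auto)
  have loc: "ell2_function (\<lambda>x. tail m (f x)) (h m)" for m
    unfolding h_def[abs_def]
  proof (rule ell2_functionI)
    show "AE x in muG. summable (\<lambda>n. (tail m (f x) n)\<^sup>2)"
      using s by eventually_elim (rule summable_tail)
  qed (use mt h_int in \<open>auto simp: h_def[abs_def]\<close>)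
  have small: "AE x in muG. \<exists>m. x \<notin> {x. \<exists>k. e < avg k (h m) x}" if e: "0 < e" for e
  proof (rule AE_ex_notin)
    show "{x. \<exists>k. e < avg k (h m) x} \<in> sets muG" for m
    proof -
      have "{x. \<exists>k. e < avg k (h m) x} = (\<Union>k. {x. e < avg k (h m) x})" by auto
      moreover have "{x. e < avg k (h m) x} \<in> sets muG" for k by (rule sets_muG_gt) measurable
      ultimately show ?thesis by auto
    qed
    show "(\<lambda>m. measure muG {x. \<exists>k. e < avg k (h m) x}) \<longlonglongrightarrow> 0"
    proof (rule tendsto_sandwich[where f="\<lambda>_. 0"])
      show "(\<lambda>m. (\<integral>x. h m x \<partial>muG) / e) \<longlonglongrightarrow> 0"
        using tendsto_divide[OF h_lim tendsto_const, of e] e by simp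
      show "\<forall>\<^sub>F m in sequentially. measure muG {x. \<exists>k. e < avg k (h m) x} \<le> (\<integral>x. h m x \<partial>muG) / e"
        using ell2_function.weak_type_maximal[OF loc e] e by (simp add: field_simps)
    qed auto
  qed
  \<comment> \<open>Thresholds are restricted to a sequence tending to 0, so that one null set
    serves them all.\<close>
  have "AE x in muG. \<forall>j::nat. \<exists>m. x \<notin> {x. \<exists>k. 1 / real (Suc j) < avg k (h m) x}"
    unfolding AE_all_countable by (intro allI small) simp
  with AE_summable_mdiff show ?thesis
  proof eventually_elim
    case (elim x)
    show ?case
    proof (rule pv_conv_mdiff[OF coord_int elim(1)])
      fix e :: real assume "0 < e"
      then obtain j where j: "1 / real (Suc j) < sqrt e"
        using reals_Archimedean[of "sqrt e"] by (auto simp: inverse_eq_divide)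
      obtain m where m: "\<And>k. avg k (h m) x \<le> 1 / real (Suc j)"
        using elim(2) by (auto simp: not_less)
      interpret T: ell2_function "\<lambda>x. tail m (f x)" "h m" by (rule loc)
      have "(\<Sum>n<M. (avg N (\<lambda>x. tail m (f x) n) x)\<^sup>2) \<le> e" for M N
      proof -
        have "(\<Sum>n<M. (avg N (\<lambda>x. tail m (f x) n) x)\<^sup>2) \<le> (avg N (h m) x)\<^sup>2"
          using T.energy_le[of M N x] by (simp add: T.energy_def)
        also have "\<dots> \<le> (sqrt e)\<^sup>2"
          using m[of N] j T.avg_phi_nonneg[of N x] by (intro power_mono) auto
        finally show ?thesis using \<open>0 < e\<close> by simp
      qed
      then show "\<exists>m. \<forall>M N. (\<Sum>n<M. (avg N (\<lambda>x. tail m (f x) n) x)\<^sup>2) \<le> e" by blast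
    qed
  qed
qed

section \<open>Weak and strong bounds for the projected function\<close>

lemma weak_type_mdiff:
  assumes f: "inLp 1 f" and t: "0 < t"
  shows "ennreal t * emeasure muG {x \<in> space muG. l2norm (\<lambda>n. mdiff n (\<lambda>x. f x n) x) > t}
       \<le> ennreal 3 * (\<integral>\<^sup>+ x. ennreal (l2norm (f x)) \<partial>muG)"
proof -
  interpret ell2_function f "\<lambda>x. \<bar>l2norm (f x)\<bar>" by (rule inLp_ell2_function[OF f]) simp
  let ?g = "\<lambda>x n. mdiff n (\<lambda>x. f x n) x"
  have s: "AE x in muG. summable (\<lambda>n. (f x n)\<^sup>2)" using f by (auto simp: inLp_def)
  have "(\<integral>\<^sup>+ x. ennreal (l2norm (f x)) \<partial>muG) = (\<integral>\<^sup>+ x. ennreal (\<bar>l2norm (f x)\<bar>) \<partial>muG)"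
    by (rule nn_integral_cong_AE) (use s in eventually_elim, simp add: l2norm_nonneg)
  also have "\<dots> = ennreal (\<integral>x. \<bar>l2norm (f x)\<bar> \<partial>muG)"
    by (rule nn_integral_eq_integral[OF phi_int]) auto
  finally have F: "(\<integral>\<^sup>+ x. ennreal (l2norm (f x)) \<partial>muG) = ennreal (\<integral>x. \<bar>l2norm (f x)\<bar> \<partial>muG)" .
  have "emeasure muG {x \<in> space muG. l2norm (?g x) > t} \<le> emeasure muG {x. \<exists>m. t\<^sup>2 < sq m x}"
  proof (rule emeasure_mono_AE[OF _ sets_sup_sq_gt])
    show "AE x in muG. x \<in> {x \<in> space muG. l2norm (?g x) > t} \<longrightarrow> x \<in> {x. \<exists>m. t\<^sup>2 < sq m x}"
      using AE_summable_mdiff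
    proof eventually_elim
      case (elim x)
      have "\<exists>m. t\<^sup>2 < sq m x" if "t < l2norm (?g x)"
      proof (rule ccontr)
        assume "\<nexists>m. t\<^sup>2 < sq m x"
        then have "(\<Sum>n. (?g x n)\<^sup>2) \<le> t\<^sup>2"
          by (intro suminf_le_const elim) (auto simp: sq_def not_less)
        then show False using that t l2norm_square[OF elim] power_strict_mono[OF that, of 2] by simp
      qed
      then show ?case by simp
    qed
  qed
  then have "ennreal t * emeasure muG {x \<in> space muG. l2norm (?g x) > t} \<le> ennreal t * emeasure muG {x. \<exists>m. t\<^sup>2 < sq m x}"
    by (rule mult_left_mono) simp
  also have "\<dots> = ennreal (t * measure muG {x. \<exists>m. t\<^sup>2 < sq m x})"
    using t by (simp add: muG.emeasure_eq_measure ennreal_mult)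
  also have "\<dots> \<le> ennreal (3 * (\<integral>x. \<bar>l2norm (f x)\<bar> \<partial>muG))"
    by (rule ennreal_leI) (rule weak_type_sup_sq[OF t])
  also have "\<dots> = ennreal 3 * (\<integral>\<^sup>+ x. ennreal (l2norm (f x)) \<partial>muG)"
    unfolding F by (rule ennreal_mult) auto
  finally show ?thesis .
qed

text \<open>Fatou's lemma transfers the bound, uniform in \<open>m\<close>, from the partial square
  functions to the full norm.\<close>

lemma Lp_mdiff:
  assumes p: "1 < p" and f: "inLp p f"
  shows "(\<integral>\<^sup>+ x. ennreal (l2norm (\<lambda>n. mdiff n (\<lambda>x. f x n) x) powr p) \<partial>muG)
       \<le> ennreal (Lp_bound p) * (\<integral>\<^sup>+ x. ennreal (l2norm (f x) powr p) \<partial>muG)"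
proof -
  interpret ell2_function f "\<lambda>x. \<bar>l2norm (f x)\<bar>" using p by (intro inLp_ell2_function[OF f]) simp
  let ?g = "\<lambda>x n. mdiff n (\<lambda>x. f x n) x"
  have int: "integrable muG (\<lambda>x. \<bar>l2norm (f x)\<bar> powr p)" using inLp_integrable(1)[OF f] p by simp
  have [measurable]: "sq m \<in> borel_measurable muG" for m using bdd_meas_sq by auto
  have "(\<integral>\<^sup>+ x. ennreal (l2norm (?g x) powr p) \<partial>muG)
     = (\<integral>\<^sup>+ x. liminf (\<lambda>m. ennreal (sq m x powr (p / 2))) \<partial>muG)"
  proof (rule nn_integral_cong_AE, use AE_summable_mdiff in eventually_elim)
    case (elim x)
    have "(\<lambda>m. sq m x) \<longlonglongrightarrow> (\<Sum>n. (?g x n)\<^sup>2)"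
      unfolding sq_def by (rule summable_LIMSEQ[OF elim])
    then have "(\<lambda>m. sq m x powr (p / 2)) \<longlonglongrightarrow> (\<Sum>n. (?g x n)\<^sup>2) powr (p / 2)"
      using p sq_nonneg by (intro tendsto_powr') auto
    moreover have "(\<Sum>n. (?g x n)\<^sup>2) powr (p / 2) = l2norm (?g x) powr p"
      using suminf_nonneg[OF elim] by (simp add: l2norm_def powr_half_sqrt[symmetric] powr_powr)
    ultimately have "(\<lambda>m. ennreal (sq m x powr (p / 2))) \<longlonglongrightarrow> ennreal (l2norm (?g x) powr p)"
      by (simp add: tendsto_ennrealI)
    then show ?case using lim_imp_Liminf[OF sequentially_bot] by metis
  qed
  also have "\<dots> \<le> liminf (\<lambda>m. \<integral>\<^sup>+ x. ennreal (sq m x powr (p / 2)) \<partial>muG)"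
    by (rule nn_integral_liminf) measurable
  also have "\<dots> \<le> liminf (\<lambda>m::nat. ennreal (Lp_bound p * (\<integral>x. \<bar>l2norm (f x)\<bar> powr p \<partial>muG)))"
  proof (rule Liminf_mono, rule always_eventually, rule allI)
    fix m
    have "integrable muG (\<lambda>x. sq m x powr (p / 2))"
      using p by (intro bdd_meas_integrable bdd_meas_powr bdd_meas_sq sq_nonneg) simp
    then have "(\<integral>\<^sup>+ x. ennreal (sq m x powr (p / 2)) \<partial>muG) = ennreal (\<integral>x. sq m x powr (p / 2) \<partial>muG)"
      by (intro nn_integral_eq_integral) auto
    also have "\<dots> \<le> ennreal (Lp_bound p * (\<integral>x. \<bar>l2norm (f x)\<bar> powr p \<partial>muG))"
      by (rule ennreal_leI) (rule sq_Lp[OF p int])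
    finally show "(\<integral>\<^sup>+ x. ennreal (sq m x powr (p / 2)) \<partial>muG) \<le> ennreal (Lp_bound p * (\<integral>x. \<bar>l2norm (f x)\<bar> powr p \<partial>muG))" .
  qed
  also have "\<dots> = ennreal (Lp_bound p * (\<integral>x. \<bar>l2norm (f x)\<bar> powr p \<partial>muG))"
    by (rule Liminf_const) simp
  also have "\<dots> = ennreal (Lp_bound p) * (\<integral>\<^sup>+ x. ennreal (l2norm (f x) powr p) \<partial>muG)"
    using inLp_integrable(2)[OF f] p Lp_bound_pos[OF p] by (simp add: ennreal_mult)
  finally show ?thesis .
qed

section \<open>The orthogonal projection\<close>

lemma inLp2_coord_square:
  assumes f: "inLp 2 f"
  shows "integrable muG (\<lambda>x. (f x n)\<^sup>2)" "summable (\<lambda>n. \<integral>x. (f x n)\<^sup>2 \<partial>muG)"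
proof -
  interpret ell2_function f "\<lambda>x. \<bar>l2norm (f x)\<bar>" by (rule inLp_ell2_function[OF f]) simp
  have int: "integrable muG (\<lambda>x. (l2norm (f x))\<^sup>2)" using inLp_integrable(1)[OF f] by simp
  show i: "integrable muG (\<lambda>x. (f x n)\<^sup>2)" for n
  proof (rule Bochner_Integration.integrable_bound[OF int])
    show "AE x in muG. norm ((f x n)\<^sup>2) \<le> norm ((l2norm (f x))\<^sup>2)"
      using coord_le[of n] by eventually_elim (simp flip: abs_le_square_iff)
  qed measurable
  show "summable (\<lambda>n. \<integral>x. (f x n)\<^sup>2 \<partial>muG)"
  proof (rule summableI_nonneg_bounded)
    fix m
    have "(\<Sum>n<m. \<integral>x. (f x n)\<^sup>2 \<partial>muG) = (\<integral>x. (\<Sum>n<m. (f x n)\<^sup>2) \<partial>muG)"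
      using i by (intro Bochner_Integration.integral_sum[symmetric])
    also have "\<dots> \<le> (\<integral>x. (l2norm (f x))\<^sup>2 \<partial>muG)"
      using sum_square_dominated[of m] by (intro integral_mono_AE int Bochner_Integration.integrable_sum i) simp
    finally show "(\<Sum>n<m. \<integral>x. (f x n)\<^sup>2 \<partial>muG) \<le> (\<integral>x. (l2norm (f x))\<^sup>2 \<partial>muG)" .
  qed simp
qed

lemma inLp2_coord_int:
  assumes f: "inLp 2 f"
  shows "integrable muG (\<lambda>x. f x n)"
proof -
  interpret ell2_function f "\<lambda>x. \<bar>l2norm (f x)\<bar>" by (rule inLp_ell2_function[OF f]) simp
  show ?thesis by (rule coord_int)
qed

lemma inH2_mdiff:
  assumes "inH2 h"
  shows "AE x in muG. h x n = mdiff n (\<lambda>x. h x n) x"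
proof -
  have "AE x in muG. Delta n (\<lambda>y. h y n) x = h x n"
    "AE x in muG. Delta n (\<lambda>y. h y n) x = mdiff n (\<lambda>y. h y n) x"
    using assms by (simp_all add: inH2_def Delta_eq_mdiff inLp2_coord_int)
  then show ?thesis by eventually_elim simp
qed

text \<open>The L^p bound with \<open>p = 2\<close> gives square integrability; idempotence of
  \<open>mdiff n\<close> places the result in the range.\<close>

lemma inH2_mdiff_proj:
  assumes f: "inLp 2 f"
  shows "inH2 (\<lambda>x n. mdiff n (\<lambda>x. f x n) x)"
proof -
  interpret ell2_function f "\<lambda>x. \<bar>l2norm (f x)\<bar>" by (rule inLp_ell2_function[OF f]) simp
  have "(\<integral>\<^sup>+ x. ennreal (l2norm (\<lambda>n. mdiff n (\<lambda>x. f x n) x) powr 2) \<partial>muG)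
       \<le> ennreal (Lp_bound 2) * (\<integral>\<^sup>+ x. ennreal (l2norm (f x) powr 2) \<partial>muG)"
    by (rule Lp_mdiff[OF _ f]) simp
  also have "\<dots> < \<infinity>"
    using f by (auto simp: inLp_def ennreal_mult_less_top)
  finally have "inLp 2 (\<lambda>x n. mdiff n (\<lambda>x. f x n) x)"
    using AE_summable_mdiff by (simp add: inLp_def)
  moreover have "AE x in muG. Delta n (mdiff n (\<lambda>x. f x n)) x = mdiff n (\<lambda>x. f x n) x" for n
    using Delta_eq_mdiff[OF bdd_meas_integrable[OF bdd_meas_mdiff[OF coord_int]], of n n n]
    by (simp add: mdiff_mdiff[OF coord_int])
  ultimately show ?thesis by (simp add: inH2_def)
qed

text \<open>Elements of \<open>inH2\<close> are reproduced coordinatewise by \<open>mdiff n\<close>,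
  so self-adjointness makes each coordinate pairing vanish. The rest of the proof justifies
  exchanging sum and integral.\<close>

lemma is_orth_proj_mdiff:
  assumes f: "inLp 2 f"
  shows "is_orth_proj f (\<lambda>x n. mdiff n (\<lambda>x. f x n) x)"
  unfolding is_orth_proj_def
proof (intro conjI allI impI)
  show g: "inH2 (\<lambda>x n. mdiff n (\<lambda>x. f x n) x)" by (rule inH2_mdiff_proj[OF f])
  fix h assume h: "inH2 h"
  then have h2: "inLp 2 h" by (simp add: inH2_def)
  have g2: "inLp 2 (\<lambda>x n. mdiff n (\<lambda>x. f x n) x)" using g by (simp add: inH2_def)
  define g where "g x n = mdiff n (\<lambda>x. f x n) x" for x n
  have g2: "inLp 2 g" using g2 by (simp add: g_def[abs_def])
  note fi = inLp2_coord_int[OF f] and hi = inLp2_coord_int[OF h2]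
  have [measurable]: "(\<lambda>x. f x n) \<in> borel_measurable muG" "(\<lambda>x. h x n) \<in> borel_measurable muG"
    "(\<lambda>x. g x n) \<in> borel_measurable muG" for n
    using f h2 g2 by (auto simp: inLp_def)
  \<comment> \<open>A majorant of the products whose series converges almost everywhere, and also
    after integration.\<close>
  let ?D = "\<lambda>x n. 2 * (f x n)\<^sup>2 + 2 * (g x n)\<^sup>2 + (h x n)\<^sup>2"
  have bound: "\<bar>(f x n - g x n) * h x n\<bar> \<le> ?D x n" for x n
  proof -
    have "2 * (\<bar>f x n - g x n\<bar> * \<bar>h x n\<bar>) \<le> (f x n - g x n)\<^sup>2 + (h x n)\<^sup>2"
      using sum_squares_bound[of "\<bar>f x n - g x n\<bar>" "\<bar>h x n\<bar>"] by simp
    moreover have "(f x n - g x n)\<^sup>2 \<le> 2 * (f x n)\<^sup>2 + 2 * (g x n)\<^sup>2"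
      using zero_le_power2[of "f x n + g x n"] by (simp add: power2_eq_square algebra_simps)
    moreover have "0 \<le> \<bar>f x n - g x n\<bar> * \<bar>h x n\<bar>" by simp
    ultimately show ?thesis unfolding abs_mult by linarith
  qed
  have Di: "integrable muG (\<lambda>x. ?D x n)" for n
    using inLp2_coord_square(1) f g2 h2 by simp
  have int: "integrable muG (\<lambda>x. (f x n - g x n) * h x n)" for n
    by (rule Bochner_Integration.integrable_bound[OF Di[of n]])
       (use bound in \<open>auto intro!: order_trans[OF bound]\<close>)
  have zero: "(\<integral>x. (f x n - g x n) * h x n \<partial>muG) = 0" for n
  proof -
    let ?H = "mdiff n (\<lambda>x. h x n)"
    have bH: "bdd_meas ?H" using hi by auto
    have bg: "bdd_meas (\<lambda>x. g x n)" unfolding g_def using fi by auto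
    have i1: "integrable muG (\<lambda>x. f x n * ?H x)"
      using bdd_meas_mult_integrable[OF bH fi[of n]] by (simp add: mult.commute)
    have i2: "integrable muG (\<lambda>x. g x n * ?H x)"
      by (intro bdd_meas_integrable bdd_meas_mult bg bH)
    have "(\<integral>x. (f x n - g x n) * h x n \<partial>muG) = (\<integral>x. f x n * ?H x - g x n * ?H x \<partial>muG)"
    proof (rule integral_cong_AE)
      show "AE x in muG. (f x n - g x n) * h x n = f x n * ?H x - g x n * ?H x"
        using inH2_mdiff[OF h, of n] by eventually_elim (simp add: left_diff_distrib)
    qed measurable
    also have "\<dots> = 0"
      using i1 i2 integral_mdiff_mult_mdiff[OF fi[of n] hi[of n], of n] by (simp add: g_def)
    finally show ?thesis .
  qed
  have "(\<integral>x. (\<Sum>n. (f x n - g x n) * h x n) \<partial>muG) = (\<Sum>n. \<integral>x. (f x n - g x n) * h x n \<partial>muG)"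
  proof (rule integral_suminf[OF int])
    have "AE x in muG. summable (\<lambda>n. (f x n)\<^sup>2)" "AE x in muG. summable (\<lambda>n. (g x n)\<^sup>2)"
      "AE x in muG. summable (\<lambda>n. (h x n)\<^sup>2)"
      using f g2 h2 by (simp_all add: inLp_def)
    then show "AE x in muG. summable (\<lambda>n. norm ((f x n - g x n) * h x n))"
    proof eventually_elim
      case (elim x)
      then have "summable (?D x)" by (intro summable_add summable_mult)
      then show ?case by (rule summable_comparison_test[rotated]) (use bound in auto)
    qed
    show "summable (\<lambda>n. \<integral>x. norm ((f x n - g x n) * h x n) \<partial>muG)"
    proof (rule summable_comparison_test)
      show "summable (\<lambda>n. \<integral>x. ?D x n \<partial>muG)"
        using inLp2_coord_square f g2 h2 by (simp add: summable_add summable_mult)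
      have "(\<integral>x. \<bar>(f x n - g x n) * h x n\<bar> \<partial>muG) \<le> (\<integral>x. ?D x n \<partial>muG)" for n
        using int by (intro integral_mono Di bound) auto
      then show "\<exists>N. \<forall>n\<ge>N. norm (\<integral>x. norm ((f x n - g x n) * h x n) \<partial>muG) \<le> (\<integral>x. ?D x n \<partial>muG)"
        by auto
    qed
  qed
  then show "(\<integral>x. (\<Sum>n. (f x n - mdiff n (\<lambda>x. f x n) x) * h x n) \<partial>muG) = 0"
    by (simp add: zero flip: g_def)
qed

text \<open>Testing coordinate by coordinate shows that \<open>mdiff n\<close> of the n-th
  coordinate of the difference of \<open>f\<close> and \<open>g\<close> has zero square integral,
  and \<open>g\<close> is reproduced by \<open>mdiff n\<close> since it satisfies
  \<open>inH2\<close>.\<close>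

lemma is_orth_proj_unique:
  assumes f: "inLp 2 f" and g: "is_orth_proj f g"
  shows "AE x in muG. g x = (\<lambda>n. mdiff n (\<lambda>x. f x n) x)"
proof -
  have gH: "inH2 g" and orth: "\<And>h. inH2 h \<Longrightarrow> (\<integral>x. (\<Sum>n. (f x n - g x n) * h x n) \<partial>muG) = 0"
    using g by (auto simp: is_orth_proj_def)
  have g2: "inLp 2 g" using gH by (simp add: inH2_def)
  note fi = inLp2_coord_int[OF f] and gi = inLp2_coord_int[OF g2]
  have "AE x in muG. g x n = mdiff n (\<lambda>x. f x n) x" for n
  proof -
    define v where "v x = f x n - g x n" for x
    define u where "u = mdiff n v"
    have vi: "integrable muG v" unfolding v_def[abs_def] using fi gi by simp
    have bu: "bdd_meas u" unfolding u_def using vi by auto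
    have [measurable]: "u \<in> borel_measurable muG" using bu by auto
    \<comment> \<open>With a single nonzero coordinate the orthogonality relation becomes scalar;
      this test function satisfies \<open>inH2\<close> because \<open>u\<close> is itself a
      difference of level \<open>n\<close>.\<close>
    define h where "h x k = (if k = n then u x else 0)" for x :: cantor and k :: nat
    have sums: "(\<lambda>k. (h x k)\<^sup>2) sums (u x)\<^sup>2" for x
      using sums_single[of n "\<lambda>_. (u x)\<^sup>2"] by (simp add: h_def if_distrib[of "\<lambda>z. z\<^sup>2"] cong: if_cong)
    have "inH2 h"
      unfolding inH2_def inLp_def
    proof (intro conjI allI)
      show "(\<lambda>x. h x k) \<in> borel_measurable muG" for k by (cases "k = n") (simp_all add: h_def)
      show "AE x in muG. summable (\<lambda>k. (h x k)\<^sup>2)" using sums by (auto simp: sums_iff)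
      have "l2norm (h x) powr 2 = (u x)\<^sup>2" for x
        using sums[of x] by (simp add: l2norm_def sums_iff)
      moreover have "(\<integral>\<^sup>+ x. ennreal ((u x)\<^sup>2) \<partial>muG) < \<infinity>"
        using bdd_meas_integrable[OF bdd_meas_power2[OF bu]]
        by (subst nn_integral_eq_integral) auto
      ultimately show "(\<integral>\<^sup>+ x. ennreal (l2norm (h x) powr 2) \<partial>muG) < \<infinity>" by simp
      show "AE x in muG. Delta k (\<lambda>y. h y k) x = h x k" for k
      proof (cases "k = n")
        case True
        then show ?thesis
          using Delta_eq_mdiff[OF bdd_meas_integrable[OF bu], of n] by (simp add: h_def u_def mdiff_mdiff[OF vi])
      next
        case False
        have "mdiff k (\<lambda>_. 0) x = 0" for x by (simp add: mdiff_def split: nat.split)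
        then show ?thesis using False Delta_eq_mdiff[of "\<lambda>_. 0" k] by (simp add: h_def)
      qed
    qed
    from orth[OF this] have 0: "(\<integral>x. (\<Sum>k. (f x k - g x k) * h x k) \<partial>muG) = 0" .
    have "(\<Sum>k. (f x k - g x k) * h x k) = v x * u x" for x
      using sums_unique[OF sums_single[of n "\<lambda>k. (f x k - g x k) * u x"]]
      by (simp add: h_def v_def if_distrib[of "\<lambda>z. _ * z"] cong: if_cong)
    then have "(\<integral>x. v x * u x \<partial>muG) = 0" using 0 by simp
    then have "(\<integral>x. (u x)\<^sup>2 \<partial>muG) = 0"
      using integral_mdiff_mult_mdiff[OF vi vi, of n] by (simp add: u_def power2_eq_square)
    then have "AE x in muG. u x = 0"
      using integral_nonneg_eq_0_iff_AE[OF bdd_meas_integrable[OF bdd_meas_power2[OF bu]]] by simp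
    then show ?thesis using inH2_mdiff[OF gH, of n]
    proof eventually_elim
      case (elim x)
      then show ?case using mdiff_diff[OF fi[of n] gi[of n], of n x]
        by (simp add: u_def v_def[abs_def])
    qed
  qed
  then have "AE x in muG. \<forall>n. g x n = mdiff n (\<lambda>x. f x n) x" by (simp add: AE_all_countable)
  then show ?thesis by eventually_elim auto
qed

theorem theorem4p10:
  shows "(\<forall>f. inLp 2 f \<longrightarrow>
            (\<exists>g. is_orth_proj f g) \<and>
            (\<forall>g. is_orth_proj f g \<longrightarrow> (AE x in muG. pv_conv f x (g x))))
   \<and> (\<exists>C>0. \<forall>f. inLp 1 f \<longrightarrow>
         (\<exists>g. (\<forall>n. (\<lambda>x. g x n) \<in> borel_measurable muG)
              \<and> (AE x in muG. pv_conv f x (g x))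
              \<and> (\<forall>t>0. ennreal t * emeasure muG {x \<in> space muG. l2norm (g x) > t}
                        \<le> ennreal C * (\<integral>\<^sup>+ x. ennreal (l2norm (f x)) \<partial>muG))))
   \<and> (\<forall>p>1. \<exists>C>0. \<forall>f. inLp p f \<longrightarrow>
         (\<exists>g. (\<forall>n. (\<lambda>x. g x n) \<in> borel_measurable muG)
              \<and> (AE x in muG. pv_conv f x (g x))
              \<and> (\<integral>\<^sup>+ x. ennreal (l2norm (g x) powr p) \<partial>muG)
                   \<le> ennreal C * (\<integral>\<^sup>+ x. ennreal (l2norm (f x) powr p) \<partial>muG)))"
proof (intro conjI)
  \<comment> \<open>One witness, the sequence of \<open>mdiff n\<close> applied to the coordinates
    of \<open>f\<close>, serves in all parts.\<close>
  have meas: "\<forall>n. (\<lambda>x. mdiff n (\<lambda>x. f x n) x) \<in> borel_measurable muG" if "inLp p f" for p f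
    using that by (simp add: inLp_def borel_measurable_mdiff)
  show "\<forall>f. inLp 2 f \<longrightarrow> (\<exists>g. is_orth_proj f g) \<and>
            (\<forall>g. is_orth_proj f g \<longrightarrow> (AE x in muG. pv_conv f x (g x)))"
  proof (intro allI impI conjI)
    fix f assume f: "inLp 2 f"
    show "\<exists>g. is_orth_proj f g" using is_orth_proj_mdiff[OF f] by blast
    fix g assume "is_orth_proj f g"
    \<comment> \<open>Any orthogonal projection agrees almost everywhere with the explicit one and
      so inherits the limit.\<close>
    from is_orth_proj_unique[OF f this] AE_pv_conv_mdiff[OF f]
    show "AE x in muG. pv_conv f x (g x)" by (auto elim: eventually_elim2)
  qed
  show "\<exists>C>0. \<forall>f. inLp 1 f \<longrightarrow>
         (\<exists>g. (\<forall>n. (\<lambda>x. g x n) \<in> borel_measurable muG)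
              \<and> (AE x in muG. pv_conv f x (g x))
              \<and> (\<forall>t>0. ennreal t * emeasure muG {x \<in> space muG. l2norm (g x) > t}
                        \<le> ennreal C * (\<integral>\<^sup>+ x. ennreal (l2norm (f x)) \<partial>muG)))"
  proof (intro exI[of _ 3] conjI allI impI)
    fix f assume f: "inLp 1 f"
    show "\<exists>g. (\<forall>n. (\<lambda>x. g x n) \<in> borel_measurable muG)
              \<and> (AE x in muG. pv_conv f x (g x))
              \<and> (\<forall>t>0. ennreal t * emeasure muG {x \<in> space muG. l2norm (g x) > t}
                        \<le> ennreal 3 * (\<integral>\<^sup>+ x. ennreal (l2norm (f x)) \<partial>muG))"
      using meas[OF f] AE_pv_conv_mdiff[OF f] weak_type_mdiff[OF f]
      by (intro exI[of _ "\<lambda>x n. mdiff n (\<lambda>x. f x n) x"]) simp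
  qed simp
  show "\<forall>p>1. \<exists>C>0. \<forall>f. inLp p f \<longrightarrow>
         (\<exists>g. (\<forall>n. (\<lambda>x. g x n) \<in> borel_measurable muG)
              \<and> (AE x in muG. pv_conv f x (g x))
              \<and> (\<integral>\<^sup>+ x. ennreal (l2norm (g x) powr p) \<partial>muG)
                   \<le> ennreal C * (\<integral>\<^sup>+ x. ennreal (l2norm (f x) powr p) \<partial>muG))"
  proof (intro allI impI)
    fix p :: real assume p: "1 < p"
    show "\<exists>C>0. \<forall>f. inLp p f \<longrightarrow>
         (\<exists>g. (\<forall>n. (\<lambda>x. g x n) \<in> borel_measurable muG)
              \<and> (AE x in muG. pv_conv f x (g x))
              \<and> (\<integral>\<^sup>+ x. ennreal (l2norm (g x) powr p) \<partial>muG)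
                   \<le> ennreal C * (\<integral>\<^sup>+ x. ennreal (l2norm (f x) powr p) \<partial>muG))"
    proof (intro exI[of _ "Lp_bound p"] conjI allI impI)
      fix f assume f: "inLp p f"
      show "\<exists>g. (\<forall>n. (\<lambda>x. g x n) \<in> borel_measurable muG)
              \<and> (AE x in muG. pv_conv f x (g x))
              \<and> (\<integral>\<^sup>+ x. ennreal (l2norm (g x) powr p) \<partial>muG)
                   \<le> ennreal (Lp_bound p) * (\<integral>\<^sup>+ x. ennreal (l2norm (f x) powr p) \<partial>muG)"
        using meas[OF f] AE_pv_conv_mdiff[OF f] Lp_mdiff[OF p f] p
        by (intro exI[of _ "\<lambda>x n. mdiff n (\<lambda>x. f x n) x"]) simp
    qed (rule Lp_bound_pos[OF p])
  qed
qed

end
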